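(* Let $a$ be a non-negative integer, $b\in\mathbb{C}$ with $b(b-a-1)\ne0$, $N\ge1$ an integer, and $\alpha_1,\dots,\alpha_{N-1}\in\mathbb{C}$ non-zero. Consider the $N$-generation representation of $SU(2/1)$ of dimension $Nd$, $d=4(a+1)$, built on $N$ copies of the typical irreducible representation $R(a,b)$ as described in the context, with $J$ the $N\times N$ matrix with entries $J_{i,i+1}=\alpha_i$ and zero elsewhere. Then on this representation the quadratic Casimir $C_2$, the ghost Casimir $T$ and the cubic Casimir $C_3$ act as $$C_2=\big(p\,I_N+q\,J+J^2\big)\otimes I_d,\qquad T=\big(p\,I_N+q\,J+J^2\big)\otimes\chi,\qquad C_3=\big(r\,I_N+s\,J+t\,J^2+J^3\big)\otimes I_d,$$ where $$p=b(b-a-1),\quad q=2b-a-1,\quad r=\tfrac12b(b-a-1)(2b-a-1),$$ $$s=3(b-a)(b-1)+\tfrac12\big((a-2)^2-3\big),\quad t=\tfrac32(2b-a-1),$$ and $\chi$ is the chirality operator of $R(a,b)$. In particular $T=C_2\,(I_N\otimes\chi)$.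
   Context: $SU(2/1)$ denotes the complex Lie superalgebra $sl(2/1,\mathbb{C})$ with even generators $F,H,E,Y$ and odd generators $U,V,W,X$. In its fundamental representation on $\mathbb{C}^{2|1}$ (with $E_{ij}$ the matrix units): $F=E_{21}$, $H=E_{11}-E_{22}$, $E=E_{12}$, $Y=-E_{11}-E_{22}-2E_{33}$, $U=-E_{23}$, $V=E_{32}$, $W=-E_{13}$, $X=E_{31}$; all (anti)commutation relations can be read off from these matrices. Representation $R(a,b)$: basis $F^n\Lambda$ ($0\le n\le a$), $F^nV\Lambda$ ($0\le n\le a+1$), $F^n\omega$ ($0\le n\le a-1$), $F^nVFV\Lambda$ ($0\le n\le a$); symbols with $n$ out of range denote $0$. For $x=\Lambda,V\Lambda,\omega,VFV\Lambda$ put $c_x=a,a+1,a-1,a$ and $y_x=2b-a,2b-a-1,2b-a-1,2b-a-2$. The generators act by $f:F^nx\mapsto F^{n+1}x$, $e:F^nx\mapsto n(c_x-n+1)F^{n-1}x$, $h:F^nx\mapsto(c_x-2n)F^nx$, $y:F^nx\mapsto y_xF^nx$; $uF^n\Lambda=0$, $uF^nV\Lambda=bF^n\Lambda$, $uF^n\omega=(a+1-b)F^{n+1}\Lambda$, $uF^nVFV\Lambda=(\frac{b}{a+1}-1)F^{n+1}V\Lambda+\frac{b}{a+1}F^n\omega$; $vF^n\Lambda=(1-\frac{n}{a+1})F^nV\Lambda-\frac{n}{a+1}F^{n-1}\omega$, $vF^nV\Lambda=nF^{n-1}VFV\Lambda$, $vF^n\omega=(a-n)F^nVFV\Lambda$,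 $vF^nVFV\Lambda=0$; $w=[e,u]$, and the matrix of the generator $X$ is $-[f,v]$. The chirality $\chi$ is $+1$ on $F^n\Lambda$, $F^nVFV\Lambda$ and $-1$ on $F^nV\Lambda$, $F^n\omega$. $N$-generation representation: let $u'F^n\Lambda=0$, $u'F^nV\Lambda=F^n\Lambda$, $u'F^n\omega=-F^{n+1}\Lambda$, $u'F^nVFV\Lambda=\frac1{a+1}(F^{n+1}V\Lambda+F^n\omega)$ and $w'=[e,u']$. The generators $F,H,E,V,X$ act as $I_N\otimes(\text{their matrix in }R(a,b))$, and $Y=I_N\otimes y+2J\otimes I_d$, $U=I_N\otimes u+J\otimes u'$, $W=I_N\otimes w+J\otimes w'$. Elements of the enveloping algebra: $C_2=-\tfrac14\big(H^2-Y^2+2(EF+FE)+2(UV-VU)+2(WX-XW)\big)$. $6T=-(UV-VU)-(WX-XW)+\sum_{\sigma}\mathrm{sgn}(\sigma)Z_{\sigma(1)}Z_{\sigma(2)}Z_{\sigma(3)}Z_{\sigma(4)}$, with $(Z_1,Z_2,Z_3,Z_4)=(U,V,W,X)$ and $\sigma$ over all 24 permutations. $C_3=\tfrac16\sum_{A,B,C}f_3(e^C,e^B,e^A)\,e_Ae_Be_C$, where, with $\mathrm{str}(M)=M_{11}+M_{22}-M_{33}$ in the fundamental representation, $g(x,y)=-\mathrm{str}(xy)$, $f_3(x,y,z)=\tfrac12\mathrm{str}(x(yz+(-1)^{|y||z|}zy))$ for homogeneous $x,y,z$, $(e_A)=(F,H,E,Y,U,V,W,X)$, and $(e^A)$ is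 the dual basis defined by $g(e^A,e_B)=\delta_{AB}$. *)

theory Defs
  imports
    Complex_Main
    "HOL-Combinatorics.Permutations"
    "Jordan_Normal_Form.Matrix"
begin

section \<open>Matrix preliminaries\<close>

definition kron :: "complex mat \<Rightarrow> complex mat \<Rightarrow> complex mat" (infixl "\<otimes>\<^sub>K" 75) where
  "A \<otimes>\<^sub>K B = mat (dim_row A * dim_row B) (dim_col A * dim_col B)
     (\<lambda>(i, j). A $$ (i div dim_row B, j div dim_col B) * B $$ (i mod dim_row B, j mod dim_col B))"

text \<open>Matrices of variable size are not an instance of the additive type classes, so finite
  sums of \<open>n \<times> n\<close> matrices are taken entrywise.\<close>

definition mat_sum :: "nat \<Rightarrow> ('i \<Rightarrow> complex mat) \<Rightarrow> 'i set \<Rightarrow> complex mat" where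
  "mat_sum n M S = mat n n (\<lambda>(i, j). \<Sum>x\<in>S. M x $$ (i, j))"

definition commutator :: "complex mat \<Rightarrow> complex mat \<Rightarrow> complex mat" where
  "commutator A B = A * B - B * A"


section \<open>The Lie superalgebra sl(2/1) in its fundamental representation\<close>

datatype gen = gF | gH | gE | gY | gU | gV | gW | gX

definition gens :: "gen set" where
  "gens = {gF, gH, gE, gY, gU, gV, gW, gX}"

text \<open>Arguments of \<open>mat_unit\<close> are counted from 1, matrix entries \<open>$$\<close> from 0.\<close>

definition mat_unit :: "nat \<Rightarrow> nat \<Rightarrow> complex mat" where
  "mat_unit i j = mat 3 3 (\<lambda>(k, l). if Suc k = i \<and> Suc l = j then 1 else 0)"

fun fund :: "gen \<Rightarrow> complex mat" where
  "fund gF = mat_unit 2 1"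
| "fund gH = mat_unit 1 1 - mat_unit 2 2"
| "fund gE = mat_unit 1 2"
| "fund gY = - mat_unit 1 1 - mat_unit 2 2 - 2 \<cdot>\<^sub>m mat_unit 3 3"
| "fund gU = - mat_unit 2 3"
| "fund gV = mat_unit 3 2"
| "fund gW = - mat_unit 1 3"
| "fund gX = mat_unit 3 1"

definition str :: "complex mat \<Rightarrow> complex" where
  "str M = M $$ (0, 0) + M $$ (1, 1) - M $$ (2, 2)"

definition sl21 :: "complex mat set" where
  "sl21 = {M \<in> carrier_mat 3 3. str M = 0}"

text \<open>Degree of a homogeneous element: 1 if both diagonal blocks (of sizes 2 and 1) vanish,
  0 otherwise.\<close>

definition parity :: "complex mat \<Rightarrow> nat" where
  "parity M = (if \<forall>i<3. \<forall>j<3. (i = 2 \<longleftrightarrow> j = 2) \<longrightarrow> M $$ (i, j) = 0 then 1 else 0)"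

definition g_form :: "complex mat \<Rightarrow> complex mat \<Rightarrow> complex" where
  "g_form x y = - str (x * y)"

definition f3 :: "complex mat \<Rightarrow> complex mat \<Rightarrow> complex mat \<Rightarrow> complex" where
  "f3 x y z = 1 / 2 * str (x * (y * z + (- 1) ^ (parity y * parity z) \<cdot>\<^sub>m (z * y)))"

text \<open>\<open>dual_basis A\<close> is the element $e^A$ with $g(e^A, e_B) = \delta_{AB}$, first argument upper.
  It must be sought in \<open>sl21\<close>: in gl(2/1) it would be determined only up to multiples of the
  identity.\<close>

definition dual_basis :: "gen \<Rightarrow> complex mat" where
  "dual_basis A =
     (THE M. M \<in> sl21 \<and> (\<forall>B. g_form M (fund B) = (if A = B then 1 else 0)))"

lemma fund_in_sl21: "fund A \<in> sl21"
  by (cases A) (auto simp: sl21_def str_def mat_unit_def)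

lemma g_form_fund:
  assumes "M \<in> carrier_mat 3 3"
  shows "g_form M (fund gF) = - M $$ (0, 1)" "g_form M (fund gE) = - M $$ (1, 0)"
    "g_form M (fund gH) = M $$ (1, 1) - M $$ (0, 0)"
    "g_form M (fund gY) = M $$ (0, 0) + M $$ (1, 1) - 2 * M $$ (2, 2)"
    "g_form M (fund gU) = - M $$ (2, 1)" "g_form M (fund gV) = - M $$ (1, 2)"
    "g_form M (fund gW) = - M $$ (2, 0)" "g_form M (fund gX) = - M $$ (0, 2)"
proof -
  have sum3: "sum f {0..<3} = f 0 + f 1 + f 2" for f :: "nat \<Rightarrow> complex"
    by (simp add: eval_nat_numeral)
  show "g_form M (fund gF) = - M $$ (0, 1)" "g_form M (fund gE) = - M $$ (1, 0)"
    "g_form M (fund gH) = M $$ (1, 1) - M $$ (0, 0)"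
    "g_form M (fund gY) = M $$ (0, 0) + M $$ (1, 1) - 2 * M $$ (2, 2)"
    "g_form M (fund gU) = - M $$ (2, 1)" "g_form M (fund gV) = - M $$ (1, 2)"
    "g_form M (fund gW) = - M $$ (2, 0)" "g_form M (fund gX) = - M $$ (0, 2)"
    using assms by (simp_all add: g_form_def str_def mat_unit_def scalar_prod_def sum3)
qed

lemma dual_basis_unique:
  "\<exists>!M. M \<in> sl21 \<and> (\<forall>B. g_form M (fund B) = (if A = B then 1 else 0))"
proof -
  have all_gen: "(\<forall>B. P B) \<longleftrightarrow> P gF \<and> P gH \<and> P gE \<and> P gY \<and> P gU \<and> P gV \<and> P gW \<and> P gX" for P
    by (metis gen.exhaust)
  define \<delta> where "\<delta> B = (if A = B then 1 else 0 :: complex)" for B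
  define D where "D = mat 3 3 (\<lambda>(i, j).
    [[(\<delta> gY * (-1) - \<delta> gH) / 2, - \<delta> gF, - \<delta> gX],
     [- \<delta> gE, (\<delta> gH - \<delta> gY) / 2, - \<delta> gV],
     [- \<delta> gW, - \<delta> gU, - \<delta> gY]] ! i ! j)"
  have D: "D \<in> carrier_mat 3 3" by (simp add: D_def)
  have iff: "M \<in> sl21 \<and> (\<forall>B. g_form M (fund B) = \<delta> B) \<longleftrightarrow> M = D" for M
  proof
    assume "M = D"
    show "M \<in> sl21 \<and> (\<forall>B. g_form M (fund B) = \<delta> B)"
      using D unfolding all_gen \<open>M = D\<close> g_form_fund[OF D]
      by (simp add: D_def sl21_def str_def field_simps)
  next
    assume M: "M \<in> sl21 \<and> (\<forall>B. g_form M (fund B) = \<delta> B)"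
    then have C: "M \<in> carrier_mat 3 3" and s: "M $$ (2, 2) = M $$ (0, 0) + M $$ (1, 1)"
      by (auto simp: sl21_def str_def)
    have eqs: "- M $$ (0, 1) = \<delta> gF" "- M $$ (1, 0) = \<delta> gE" "M $$ (1, 1) - M $$ (0, 0) = \<delta> gH"
      "M $$ (0, 0) + M $$ (1, 1) - 2 * M $$ (2, 2) = \<delta> gY"
      "- M $$ (2, 1) = \<delta> gU" "- M $$ (1, 2) = \<delta> gV" "- M $$ (2, 0) = \<delta> gW" "- M $$ (0, 2) = \<delta> gX"
      using M unfolding all_gen g_form_fund[OF C] by blast+
    have "M $$ (0, 0) = (\<delta> gY * (-1) - \<delta> gH) / 2" "M $$ (1, 1) = (\<delta> gH - \<delta> gY) / 2"
      "M $$ (2, 2) = - \<delta> gY"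
      unfolding eqs(3,4)[symmetric] s by (simp_all add: field_simps)
    then have "M $$ (i, j) = D $$ (i, j)" if "i = 0 \<or> i = 1 \<or> i = 2" "j = 0 \<or> j = 1 \<or> j = 2" for i j
      using that eqs by (auto simp: D_def) (metis minus_minus)+
    moreover have "i = 0 \<or> i = 1 \<or> i = 2" if "i < 3" for i :: nat
      using that by linarith
    ultimately show "M = D"
      using C D by (intro eq_matI) auto
  qed
  show ?thesis
    using iff unfolding \<delta>_def by simp
qed


section \<open>The representation R(a,b)\<close>

text \<open>\<open>(x, n)\<close> stands for the symbol $F^n x$, where \<open>x\<close> is one of
  $\Lambda$, $V\Lambda$, $\omega$, $VFV\Lambda$.\<close>

datatype sector = Lam | VLam | Omega | VFVLam

type_synonym label = "sector \<times> nat"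

definition basis :: "nat \<Rightarrow> label list" where
  "basis a = map (Pair Lam) [0..<a + 1] @ map (Pair VLam) [0..<a + 2]
           @ map (Pair Omega) [0..<a] @ map (Pair VFVLam) [0..<a + 1]"

lemma length_basis: "length (basis a) = 4 * (a + 1)"
  by (simp add: basis_def)

lemma distinct_basis: "distinct (basis a)"
  by (auto simp: basis_def distinct_map inj_on_def)

text \<open>An operator is given by the image of each basis symbol, written as a list of terms
  (coefficient, symbol). Symbols that are not in \<open>basis a\<close> do not contribute to the matrix, i.e.
  they denote 0. Whenever \<open>n - 1\<close> is truncated below, the coefficient is 0.\<close>

definition op_mat :: "nat \<Rightarrow> (label \<Rightarrow> (complex \<times> label) list) \<Rightarrow> complex mat" where
  "op_mat a act = mat (4 * (a + 1)) (4 * (a + 1))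
     (\<lambda>(i, j). \<Sum>(k, l) \<leftarrow> act (basis a ! j). if l = basis a ! i then k else 0)"

fun c_val :: "nat \<Rightarrow> sector \<Rightarrow> complex" where
  "c_val a Lam = of_nat a"
| "c_val a VLam = of_nat a + 1"
| "c_val a Omega = of_nat a - 1"
| "c_val a VFVLam = of_nat a"

fun y_val :: "nat \<Rightarrow> complex \<Rightarrow> sector \<Rightarrow> complex" where
  "y_val a b Lam = 2 * b - of_nat a"
| "y_val a b VLam = 2 * b - of_nat a - 1"
| "y_val a b Omega = 2 * b - of_nat a - 1"
| "y_val a b VFVLam = 2 * b - of_nat a - 2"

definition f_mat :: "nat \<Rightarrow> complex mat" where
  "f_mat a = op_mat a (\<lambda>(x, n). [(1, (x, n + 1))])"

definition e_mat :: "nat \<Rightarrow> complex mat" where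
  "e_mat a = op_mat a (\<lambda>(x, n). [(of_nat n * (c_val a x - of_nat n + 1), (x, n - 1))])"

definition h_mat :: "nat \<Rightarrow> complex mat" where
  "h_mat a = op_mat a (\<lambda>(x, n). [(c_val a x - 2 * of_nat n, (x, n))])"

definition y_mat :: "nat \<Rightarrow> complex \<Rightarrow> complex mat" where
  "y_mat a b = op_mat a (\<lambda>(x, n). [(y_val a b x, (x, n))])"

fun u_act :: "nat \<Rightarrow> complex \<Rightarrow> label \<Rightarrow> (complex \<times> label) list" where
  "u_act a b (Lam, n) = []"
| "u_act a b (VLam, n) = [(b, (Lam, n))]"
| "u_act a b (Omega, n) = [(of_nat a + 1 - b, (Lam, n + 1))]"
| "u_act a b (VFVLam, n) =
     [(b / (of_nat a + 1) - 1, (VLam, n + 1)), (b / (of_nat a + 1), (Omega, n))]"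

fun v_act :: "nat \<Rightarrow> label \<Rightarrow> (complex \<times> label) list" where
  "v_act a (Lam, n) =
     [(1 - of_nat n / (of_nat a + 1), (VLam, n)), (- (of_nat n / (of_nat a + 1)), (Omega, n - 1))]"
| "v_act a (VLam, n) = [(of_nat n, (VFVLam, n - 1))]"
| "v_act a (Omega, n) = [(of_nat a - of_nat n, (VFVLam, n))]"
| "v_act a (VFVLam, n) = []"

fun u'_act :: "nat \<Rightarrow> label \<Rightarrow> (complex \<times> label) list" where
  "u'_act a (Lam, n) = []"
| "u'_act a (VLam, n) = [(1, (Lam, n))]"
| "u'_act a (Omega, n) = [(- 1, (Lam, n + 1))]"
| "u'_act a (VFVLam, n) =
     [(1 / (of_nat a + 1), (VLam, n + 1)), (1 / (of_nat a + 1), (Omega, n))]"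

definition u_mat :: "nat \<Rightarrow> complex \<Rightarrow> complex mat" where
  "u_mat a b = op_mat a (u_act a b)"

definition v_mat :: "nat \<Rightarrow> complex mat" where
  "v_mat a = op_mat a (v_act a)"

definition w_mat :: "nat \<Rightarrow> complex \<Rightarrow> complex mat" where
  "w_mat a b = commutator (e_mat a) (u_mat a b)"

definition x_mat :: "nat \<Rightarrow> complex mat" where
  "x_mat a = - commutator (f_mat a) (v_mat a)"

definition u'_mat :: "nat \<Rightarrow> complex mat" where
  "u'_mat a = op_mat a (u'_act a)"

definition w'_mat :: "nat \<Rightarrow> complex mat" where
  "w'_mat a = commutator (e_mat a) (u'_mat a)"

definition chi_mat :: "nat \<Rightarrow> complex mat" where
  "chi_mat a = op_mat a (\<lambda>(x, n). [(if x = Lam \<or> x = VFVLam then 1 else - 1, (x, n))])"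


section \<open>The N-generation representation\<close>

text \<open>$J_{i,i+1} = \alpha_i$ with rows and columns counted from 1.\<close>

definition J_mat :: "nat \<Rightarrow> (nat \<Rightarrow> complex) \<Rightarrow> complex mat" where
  "J_mat N \<alpha> = mat N N (\<lambda>(i, j). if j = Suc i then \<alpha> (Suc i) else 0)"

fun ngen_rep :: "nat \<Rightarrow> complex \<Rightarrow> nat \<Rightarrow> (nat \<Rightarrow> complex) \<Rightarrow> gen \<Rightarrow> complex mat" where
  "ngen_rep a b N \<alpha> gF = 1\<^sub>m N \<otimes>\<^sub>K f_mat a"
| "ngen_rep a b N \<alpha> gH = 1\<^sub>m N \<otimes>\<^sub>K h_mat a"
| "ngen_rep a b N \<alpha> gE = 1\<^sub>m N \<otimes>\<^sub>K e_mat a"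
| "ngen_rep a b N \<alpha> gY =
     1\<^sub>m N \<otimes>\<^sub>K y_mat a b + 2 \<cdot>\<^sub>m (J_mat N \<alpha> \<otimes>\<^sub>K 1\<^sub>m (4 * (a + 1)))"
| "ngen_rep a b N \<alpha> gU = 1\<^sub>m N \<otimes>\<^sub>K u_mat a b + J_mat N \<alpha> \<otimes>\<^sub>K u'_mat a"
| "ngen_rep a b N \<alpha> gV = 1\<^sub>m N \<otimes>\<^sub>K v_mat a"
| "ngen_rep a b N \<alpha> gW = 1\<^sub>m N \<otimes>\<^sub>K w_mat a b + J_mat N \<alpha> \<otimes>\<^sub>K w'_mat a"
| "ngen_rep a b N \<alpha> gX = 1\<^sub>m N \<otimes>\<^sub>K x_mat a"


section \<open>The Casimir elements\<close>

text \<open>The elements of the enveloping algebra, evaluated on matrices \<open>\<rho> A\<close> of size \<open>n \<times> n\<close>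
  representing the generators.\<close>

definition casimir2 :: "(gen \<Rightarrow> complex mat) \<Rightarrow> complex mat" where
  "casimir2 \<rho> = (- 1 / 4) \<cdot>\<^sub>m
     (\<rho> gH * \<rho> gH - \<rho> gY * \<rho> gY
      + 2 \<cdot>\<^sub>m (\<rho> gE * \<rho> gF + \<rho> gF * \<rho> gE)
      + 2 \<cdot>\<^sub>m (\<rho> gU * \<rho> gV - \<rho> gV * \<rho> gU)
      + 2 \<cdot>\<^sub>m (\<rho> gW * \<rho> gX - \<rho> gX * \<rho> gW))"

text \<open>$Z_1, \dots, Z_4$ are indexed by 0, ..., 3.\<close>

definition ghost_casimir :: "nat \<Rightarrow> (gen \<Rightarrow> complex mat) \<Rightarrow> complex mat" where
  "ghost_casimir n \<rho> =
     (let Z = (\<lambda>i::nat. \<rho> ([gU, gV, gW, gX] ! i)) in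
      (1 / 6) \<cdot>\<^sub>m
        (- (\<rho> gU * \<rho> gV - \<rho> gV * \<rho> gU) - (\<rho> gW * \<rho> gX - \<rho> gX * \<rho> gW)
         + mat_sum n (\<lambda>\<sigma>. of_int (sign \<sigma>) \<cdot>\<^sub>m (Z (\<sigma> 0) * Z (\<sigma> 1) * Z (\<sigma> 2) * Z (\<sigma> 3)))
             {\<sigma>. \<sigma> permutes {0..<4}}))"

definition casimir3 :: "nat \<Rightarrow> (gen \<Rightarrow> complex mat) \<Rightarrow> complex mat" where
  "casimir3 n \<rho> = (1 / 6) \<cdot>\<^sub>m
     mat_sum n (\<lambda>(A, B, C). f3 (dual_basis C) (dual_basis B) (dual_basis A) \<cdot>\<^sub>m
                               (\<rho> A * \<rho> B * \<rho> C))
       (gens \<times> gens \<times> gens)"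

end

theory Submission
  imports Defs "HOL-Computational_Algebra.Polynomial"
begin

text \<open>The generators of R(a,b) depend on \<open>b\<close> affinely, and the N-generation representation is
  obtained from R(a,b+z) by substituting the matrix \<open>J\<close> for the scalar \<open>z\<close>. Substitution is a ring
  homomorphism, and an identity between polynomials in \<open>z\<close> survives it. Hence it suffices that on
  R(a,b), for every \<open>b\<close>, the three Casimir elements act as \<open>p\<close>, \<open>p \<chi>\<close> and \<open>r\<close>; the other
  coefficients are those of the Taylor expansions of \<open>p\<close> and \<open>r\<close> at \<open>b\<close>. On R(a,b) the three
  statements are checked on the symbols \<open>F\<^sup>nx\<close>, for all \<open>n\<close> at once, since symbols with \<open>n\<close> out of
  range span a submodule of the module on all symbols.\<close>

text \<open>Index \<open>k\<close> of a matrix of size \<open>N * d\<close> lies in block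
  \<open>k div d\<close> at place \<open>k mod d\<close>; this splits the inner sum of a product of
  block matrices.\<close>

lemma sum_div_mod:
  fixes h :: "nat \<Rightarrow> nat \<Rightarrow> 'a::comm_monoid_add"
  shows "(\<Sum>k<N * d. h (k div d) (k mod d)) = (\<Sum>i<N. \<Sum>j<d. h i j)"
proof -
  have "(\<Sum>k<N * d. h (k div d) (k mod d)) = (\<Sum>i<N. \<Sum>k=i * d..<i * d + d. h (k div d) (k mod d))"
    by (rule sum.nat_group[symmetric])
  also have "\<dots> = (\<Sum>i<N. \<Sum>j<d. h i j)"
  proof (rule sum.cong[OF refl])
    fix i
    have "(\<Sum>k=i * d..<i * d + d. h (k div d) (k mod d)) = (\<Sum>j=0..<d. h ((j + i * d) div d) ((j + i * d) mod d))"
      using sum.shift_bounds_nat_ivl[of "\<lambda>k. h (k div d) (k mod d)" 0 "i * d" d]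
      by (simp add: add.commute)
    also have "\<dots> = (\<Sum>j<d. h i j)"
      by (rule sum.cong) auto
    finally show "(\<Sum>k=i * d..<i * d + d. h (k div d) (k mod d)) = (\<Sum>j<d. h i j)" .
  qed
  finally show ?thesis .
qed

section \<open>Substituting \<open>J\<close> for a scalar\<close>

text \<open>The \<open>(i, j)\<close> entry of \<open>p(J)\<close>: the only path from \<open>i\<close> to \<open>j\<close> has length \<open>j - i\<close>.\<close>

definition J_entry :: "(nat \<Rightarrow> complex) \<Rightarrow> complex poly \<Rightarrow> nat \<Rightarrow> nat \<Rightarrow> complex" where
  "J_entry \<alpha> p i j = (if i \<le> j then coeff p (j - i) * (\<Prod>m\<in>{i<..j}. \<alpha> m) else 0)"

lemma J_entry_0 [simp]: "J_entry \<alpha> 0 i j = 0"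
  by (simp add: J_entry_def)

lemma J_entry_add: "J_entry \<alpha> (p + q) i j = J_entry \<alpha> p i j + J_entry \<alpha> q i j"
  by (simp add: J_entry_def algebra_simps)

lemma J_entry_smult: "J_entry \<alpha> (smult c p) i j = c * J_entry \<alpha> p i j"
  by (simp add: J_entry_def)

lemma J_entry_sum: "J_entry \<alpha> (\<Sum>x\<in>S. p x) i j = (\<Sum>x\<in>S. J_entry \<alpha> (p x) i j)"
  by (induction S rule: infinite_finite_induct) (auto simp: J_entry_add)

text \<open>The weight of the path from \<open>i\<close> to \<open>j\<close> factors at every
  \<open>m\<close> between them, so the sum over \<open>m\<close> is the Cauchy product of the
  coefficients. Stopping at \<open>N\<close> loses nothing, because only \<open>m \<le> j\<close>
  contribute.\<close>

lemma J_entry_mult: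
  assumes "j < N"
  shows "J_entry \<alpha> (p * q) i j = (\<Sum>m<N. J_entry \<alpha> p i m * J_entry \<alpha> q m j)"
proof (cases "i \<le> j")
  case True
  have "(\<Sum>m<N. J_entry \<alpha> p i m * J_entry \<alpha> q m j) = (\<Sum>m\<in>{i..j}. J_entry \<alpha> p i m * J_entry \<alpha> q m j)"
    by (rule sum.mono_neutral_right) (use assms in \<open>auto simp: J_entry_def\<close>)
  also have "\<dots> = (\<Sum>m\<in>{i..j}. coeff p (m - i) * coeff q (j - m) * (\<Prod>m\<in>{i<..j}. \<alpha> m))"
  proof (rule sum.cong[OF refl])
    fix m assume m: "m \<in> {i..j}"
    have "(\<Prod>m\<in>{i<..j}. \<alpha> m) = (\<Prod>m\<in>{i<..m}. \<alpha> m) * (\<Prod>m\<in>{m<..j}. \<alpha> m)"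
      using m by (subst prod.union_disjoint[symmetric]) (auto simp: ivl_disj_un_two)
    then show "J_entry \<alpha> p i m * J_entry \<alpha> q m j = coeff p (m - i) * coeff q (j - m) * (\<Prod>m\<in>{i<..j}. \<alpha> m)"
      using m by (simp add: J_entry_def)
  qed
  also have "\<dots> = (\<Sum>k\<le>j - i. coeff p k * coeff q (j - i - k) * (\<Prod>m\<in>{i<..j}. \<alpha> m))"
    by (rule sum.reindex_bij_witness[of _ "\<lambda>k. k + i" "\<lambda>m. m - i"]) (use True in auto)
  also have "\<dots> = J_entry \<alpha> (p * q) i j"
    using True by (simp add: J_entry_def coeff_mult sum_distrib_right)
  finally show ?thesis ..
next
  case False
  have "J_entry \<alpha> p i m * J_entry \<alpha> q m j = 0" for m
    using False by (auto simp: J_entry_def)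
  moreover have "J_entry \<alpha> (p * q) i j = 0"
    using False by (simp add: J_entry_def)
  ultimately show ?thesis
    by (simp del: mult_eq_0_iff)
qed

section \<open>Polynomials evaluated at \<open>J\<close>\<close>

definition J_eval :: "nat \<Rightarrow> (nat \<Rightarrow> complex) \<Rightarrow> complex poly \<Rightarrow> complex mat" where
  "J_eval N \<alpha> p = mat N N (\<lambda>(i, j). J_entry \<alpha> p i j)"

lemma J_eval_add: "J_eval N \<alpha> (p + q) = J_eval N \<alpha> p + J_eval N \<alpha> q"
  by (intro eq_matI) (auto simp: J_eval_def J_entry_add)

lemma J_eval_smult: "J_eval N \<alpha> (smult c p) = c \<cdot>\<^sub>m J_eval N \<alpha> p"
  by (intro eq_matI) (auto simp: J_eval_def J_entry_smult)

lemma J_eval_mult: "J_eval N \<alpha> (p * q) = J_eval N \<alpha> p * J_eval N \<alpha> q"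
  by (intro eq_matI)
    (auto simp: J_eval_def J_entry_mult scalar_prod_def atLeast0LessThan cong: sum.cong_simp)

lemma J_eval_1: "J_eval N \<alpha> 1 = 1\<^sub>m N"
  by (intro eq_matI) (auto simp: J_eval_def J_entry_def coeff_1)

text \<open>Here \<open>\<alpha>\<close> counts from 1 and entries from 0: the path from
  \<open>i\<close> to \<open>Suc i\<close> has weight \<open>\<alpha> (Suc i)\<close>. Together with
  the lemmas above this makes \<open>J_eval\<close> the algebra homomorphism that sends the variable
  to \<open>J_mat\<close>.\<close>

lemma J_eval_X: "J_eval N \<alpha> [:0, 1:] = J_mat N \<alpha>"
proof (intro eq_matI)
  fix i j assume "i < dim_row (J_mat N \<alpha>)" "j < dim_col (J_mat N \<alpha>)"
  then show "J_eval N \<alpha> [:0, 1:] $$ (i, j) = J_mat N \<alpha> $$ (i, j)"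
    by (cases "i < j"; cases "j - i")
      (auto simp: J_eval_def J_mat_def J_entry_def coeff_pCons atLeastSucAtMost_greaterThanAtMost[symmetric] split: nat.splits)
qed (auto simp: J_eval_def J_mat_def)

text \<open>\<open>M\<close> arises from the matrix family \<open>F z\<close>, polynomial in \<open>z\<close>, by substituting \<open>J\<close> for \<open>z\<close>.\<close>

definition J_subst :: "nat \<Rightarrow> nat \<Rightarrow> (nat \<Rightarrow> complex) \<Rightarrow> (complex \<Rightarrow> complex mat) \<Rightarrow> complex mat \<Rightarrow> bool" where
  "J_subst N d \<alpha> F M \<longleftrightarrow> (\<exists>P. (\<forall>z. F z = mat d d (\<lambda>(i, j). poly (P i j) z)) \<and>
     M = mat (N * d) (N * d) (\<lambda>(i, j). J_entry \<alpha> (P (i mod d) (j mod d)) (i div d) (j div d)))"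

lemma J_substI:
  assumes "\<And>z. F z = mat d d (\<lambda>(i, j). poly (P i j) z)"
    and "M = mat (N * d) (N * d) (\<lambda>(i, j). J_entry \<alpha> (P (i mod d) (j mod d)) (i div d) (j div d))"
  shows "J_subst N d \<alpha> F M"
  using assms unfolding J_subst_def by blast

lemma J_substE:
  assumes "J_subst N d \<alpha> F M"
  obtains P where "\<And>z. F z = mat d d (\<lambda>(i, j). poly (P i j) z)"
    and "M = mat (N * d) (N * d) (\<lambda>(i, j). J_entry \<alpha> (P (i mod d) (j mod d)) (i div d) (j div d))"
  using assms unfolding J_subst_def by blast

text \<open>A complex polynomial is determined by its values, so \<open>F\<close> fixes all
  \<open>P i j\<close> with \<open>i, j < d\<close>, and these fix \<open>M\<close>. This is what
  carries an identity valid for all \<open>z\<close> over to \<open>J\<close>.\<close>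

lemma J_subst_unique:
  assumes "J_subst N d \<alpha> F M" "J_subst N d \<alpha> F M'"
  shows "M = M'"
proof -
  obtain P where P: "\<And>z. F z = mat d d (\<lambda>(i, j). poly (P i j) z)"
    "M = mat (N * d) (N * d) (\<lambda>(i, j). J_entry \<alpha> (P (i mod d) (j mod d)) (i div d) (j div d))"
    using assms(1) unfolding J_subst_def by blast
  obtain P' where P': "\<And>z. F z = mat d d (\<lambda>(i, j). poly (P' i j) z)"
    "M' = mat (N * d) (N * d) (\<lambda>(i, j). J_entry \<alpha> (P' (i mod d) (j mod d)) (i div d) (j div d))"
    using assms(2) unfolding J_subst_def by blast
  have "poly (P i j) z = poly (P' i j) z" if "i < d" "j < d" for i j z
    using arg_cong[OF trans[OF P(1)[symmetric] P'(1)], of "\<lambda>A. A $$ (i, j)" z] that by simp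
  then have "P i j = P' i j" if "i < d" "j < d" for i j
    using that by (metis poly_eq_poly_eq_iff ext)
  moreover have "i mod d < d" if "i < N * d" for i
    using that by (cases "d = 0") auto
  ultimately show ?thesis
    unfolding P(2) P'(2) by (intro eq_matI) auto
qed

section \<open>Closure of the substitution under matrix operations\<close>

text \<open>Supplies the building blocks of the generators (\<open>p\<close> equal to 1 or to the
  variable) and also the right-hand sides of the theorem (\<open>p\<close> quadratic or
  cubic).\<close>

lemma J_subst_kron:
  assumes "B \<in> carrier_mat d d"
  shows "J_subst N d \<alpha> (\<lambda>z. poly p z \<cdot>\<^sub>m B) (J_eval N \<alpha> p \<otimes>\<^sub>K B)"
proof (rule J_substI[where P = "\<lambda>i j. smult (B $$ (i, j)) p"])
  have dm: "i div d < N" "i mod d < d" if "i < N * d" for i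
    using that by (simp add: less_mult_imp_div_less, cases "d = 0") auto
  show "J_eval N \<alpha> p \<otimes>\<^sub>K B = mat (N * d) (N * d)
      (\<lambda>(i, j). J_entry \<alpha> (smult (B $$ (i mod d, j mod d)) p) (i div d) (j div d))"
    using assms by (intro eq_matI) (auto simp: kron_def J_eval_def J_entry_smult dm)
qed (use assms in \<open>auto intro!: eq_matI\<close>)

lemma J_subst_smult:
  assumes "J_subst N d \<alpha> F M"
  shows "J_subst N d \<alpha> (\<lambda>z. c \<cdot>\<^sub>m F z) (c \<cdot>\<^sub>m M)"
  using assms
proof (elim J_substE)
  fix P assume "\<And>z. F z = mat d d (\<lambda>(i, j). poly (P i j) z)"
    "M = mat (N * d) (N * d) (\<lambda>(i, j). J_entry \<alpha> (P (i mod d) (j mod d)) (i div d) (j div d))"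
  then show ?thesis
    by (intro J_substI[where P = "\<lambda>i j. smult c (P i j)"]) (auto intro!: eq_matI simp: J_entry_smult)
qed

lemma J_subst_add:
  assumes "J_subst N d \<alpha> F M" "J_subst N d \<alpha> G M'"
  shows "J_subst N d \<alpha> (\<lambda>z. F z + G z) (M + M')"
  using assms
proof (elim J_substE)
  fix P Q assume "\<And>z. F z = mat d d (\<lambda>(i, j). poly (P i j) z)" "\<And>z. G z = mat d d (\<lambda>(i, j). poly (Q i j) z)"
    "M = mat (N * d) (N * d) (\<lambda>(i, j). J_entry \<alpha> (P (i mod d) (j mod d)) (i div d) (j div d))"
    "M' = mat (N * d) (N * d) (\<lambda>(i, j). J_entry \<alpha> (Q (i mod d) (j mod d)) (i div d) (j div d))"
  then show ?thesis
    by (intro J_substI[where P = "\<lambda>i j. P i j + Q i j"]) (auto intro!: eq_matI simp: J_entry_add)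
qed

lemma J_subst_minus:
  assumes "J_subst N d \<alpha> F M" "J_subst N d \<alpha> G M'"
  shows "J_subst N d \<alpha> (\<lambda>z. F z - G z) (M - M')"
proof -
  have "A - B = A + (- 1) \<cdot>\<^sub>m B" if "dim_row A = dim_row B" "dim_col A = dim_col B" for A B :: "complex mat"
    using that by (intro eq_matI) auto
  moreover have "dim_row (F z) = d" "dim_row (G z) = d" "dim_col (F z) = d" "dim_col (G z) = d"
    "dim_row M = N * d" "dim_row M' = N * d" "dim_col M = N * d" "dim_col M' = N * d" for z
    using assms by (auto elim!: J_substE)
  ultimately show ?thesis
    using J_subst_add[OF assms(1) J_subst_smult[OF assms(2), of "- 1"]] by simp
qed

lemma J_subst_uminus:
  assumes "J_subst N d \<alpha> F M"
  shows "J_subst N d \<alpha> (\<lambda>z. - F z) (- M)"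
proof -
  have "- A = (- 1) \<cdot>\<^sub>m A" for A :: "complex mat"
    by (intro eq_matI) auto
  then show ?thesis
    using J_subst_smult[OF assms, of "- 1"] by simp
qed

text \<open>The summation index splits into a place \<open>l\<close> within a block, which stays as
  a sum of polynomials, and a block number \<open>m\<close>, which \<open>J_entry_mult\<close>
  absorbs.\<close>

lemma J_subst_mult:
  assumes "J_subst N d \<alpha> F M" "J_subst N d \<alpha> G M'"
  shows "J_subst N d \<alpha> (\<lambda>z. F z * G z) (M * M')"
proof -
  obtain P where P: "\<And>z. F z = mat d d (\<lambda>(i, j). poly (P i j) z)"
    "M = mat (N * d) (N * d) (\<lambda>(i, j). J_entry \<alpha> (P (i mod d) (j mod d)) (i div d) (j div d))"
    using assms(1) unfolding J_subst_def by blast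
  obtain Q where Q: "\<And>z. G z = mat d d (\<lambda>(i, j). poly (Q i j) z)"
    "M' = mat (N * d) (N * d) (\<lambda>(i, j). J_entry \<alpha> (Q (i mod d) (j mod d)) (i div d) (j div d))"
    using assms(2) unfolding J_subst_def by blast
  show ?thesis
  proof (rule J_substI[where P = "\<lambda>i j. \<Sum>l<d. P i l * Q l j"])
    show "F z * G z = mat d d (\<lambda>(i, j). poly (\<Sum>l<d. P i l * Q l j) z)" for z
      by (intro eq_matI) (auto simp: P(1) Q(1) scalar_prod_def poly_sum atLeast0LessThan)
    have "(M * M') $$ (i, j) = J_entry \<alpha> (\<Sum>l<d. P (i mod d) l * Q l (j mod d)) (i div d) (j div d)"
      if "i < N * d" "j < N * d" for i j
    proof -
      have "(M * M') $$ (i, j) = (\<Sum>k<N * d. J_entry \<alpha> (P (i mod d) (k mod d)) (i div d) (k div d) *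
          J_entry \<alpha> (Q (k mod d) (j mod d)) (k div d) (j div d))"
        using that by (simp add: P(2) Q(2) scalar_prod_def atLeast0LessThan)
      also have "\<dots> = (\<Sum>l<d. \<Sum>m<N. J_entry \<alpha> (P (i mod d) l) (i div d) m * J_entry \<alpha> (Q l (j mod d)) m (j div d))"
        by (subst sum_div_mod[where h = "\<lambda>m l. J_entry \<alpha> (P (i mod d) l) (i div d) m *
          J_entry \<alpha> (Q l (j mod d)) m (j div d)"]) (rule sum.swap)
      also have "\<dots> = (\<Sum>l<d. J_entry \<alpha> (P (i mod d) l * Q l (j mod d)) (i div d) (j div d))"
        using that by (intro sum.cong refl J_entry_mult[symmetric] less_mult_imp_div_less)
      finally show ?thesis
        by (simp add: J_entry_sum)
    qed
    then show "M * M' = mat (N * d) (N * d)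
        (\<lambda>(i, j). J_entry \<alpha> (\<Sum>l<d. P (i mod d) l * Q l (j mod d)) (i div d) (j div d))"
      by (intro eq_matI) (auto simp: P(2) Q(2))
  qed
qed

lemma J_subst_mat_sum:
  assumes "\<And>x. x \<in> S \<Longrightarrow> J_subst N d \<alpha> (F x) (M x)"
  shows "J_subst N d \<alpha> (\<lambda>z. mat_sum d (\<lambda>x. F x z) S) (mat_sum (N * d) M S)"
proof -
  have "\<forall>x\<in>S. \<exists>P. (\<forall>z. F x z = mat d d (\<lambda>(i, j). poly (P i j) z)) \<and>
     M x = mat (N * d) (N * d) (\<lambda>(i, j). J_entry \<alpha> (P (i mod d) (j mod d)) (i div d) (j div d))"
    using assms unfolding J_subst_def by blast
  then obtain P where P: "\<And>x z. x \<in> S \<Longrightarrow> F x z = mat d d (\<lambda>(i, j). poly (P x i j) z)"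
    "\<And>x. x \<in> S \<Longrightarrow> M x = mat (N * d) (N * d) (\<lambda>(i, j). J_entry \<alpha> (P x (i mod d) (j mod d)) (i div d) (j div d))"
    unfolding bchoice_iff by blast
  show ?thesis
    by (rule J_substI[where P = "\<lambda>i j. \<Sum>x\<in>S. P x i j"])
      (auto intro!: eq_matI sum.cong simp: mat_sum_def J_entry_sum poly_sum P)
qed

lemmas J_subst_intros =
  J_subst_add J_subst_minus J_subst_uminus J_subst_smult J_subst_mult J_subst_mat_sum

lemma J_subst_const:
  assumes "B \<in> carrier_mat d d"
  shows "J_subst N d \<alpha> (\<lambda>_. B) (1\<^sub>m N \<otimes>\<^sub>K B)"
proof -
  have "1 \<cdot>\<^sub>m B = B"
    by (intro eq_matI) auto
  then show ?thesis
    using J_subst_kron[OF assms, of N \<alpha> 1] by (simp add: J_eval_1)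
qed

lemma J_subst_J:
  assumes "B \<in> carrier_mat d d"
  shows "J_subst N d \<alpha> (\<lambda>z. z \<cdot>\<^sub>m B) (J_mat N \<alpha> \<otimes>\<^sub>K B)"
  using J_subst_kron[OF assms, of N \<alpha> "[:0, 1:]"] by (simp add: J_eval_X)

section \<open>The representation R(a,b) and its deformation\<close>

text \<open>The family to be deformed: \<open>b\<close> is an argument so that \<open>b + z\<close>
  can be put in its place.\<close>

fun irrep :: "nat \<Rightarrow> complex \<Rightarrow> gen \<Rightarrow> complex mat" where
  "irrep a b gF = f_mat a"
| "irrep a b gH = h_mat a"
| "irrep a b gE = e_mat a"
| "irrep a b gY = y_mat a b"
| "irrep a b gU = u_mat a b"
| "irrep a b gV = v_mat a"
| "irrep a b gW = w_mat a b"
| "irrep a b gX = x_mat a"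

lemma basis_nth_eq_iff:
  "i < 4 * (a + 1) \<Longrightarrow> j < 4 * (a + 1) \<Longrightarrow> basis a ! i = basis a ! j \<longleftrightarrow> i = j"
  by (metis distinct_basis length_basis nth_eq_iff_index_eq)

lemma op_mat_carrier [simp]: "op_mat a act \<in> carrier_mat (4 * (a + 1)) (4 * (a + 1))"
  by (simp add: op_mat_def)

lemma rep_mat_carrier [simp]:
  "f_mat a \<in> carrier_mat (4 * (a + 1)) (4 * (a + 1))"
  "h_mat a \<in> carrier_mat (4 * (a + 1)) (4 * (a + 1))"
  "e_mat a \<in> carrier_mat (4 * (a + 1)) (4 * (a + 1))"
  "y_mat a b \<in> carrier_mat (4 * (a + 1)) (4 * (a + 1))"
  "u_mat a b \<in> carrier_mat (4 * (a + 1)) (4 * (a + 1))"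
  "v_mat a \<in> carrier_mat (4 * (a + 1)) (4 * (a + 1))"
  "u'_mat a \<in> carrier_mat (4 * (a + 1)) (4 * (a + 1))"
  "chi_mat a \<in> carrier_mat (4 * (a + 1)) (4 * (a + 1))"
  by (simp_all only: f_mat_def h_mat_def e_mat_def y_mat_def u_mat_def v_mat_def u'_mat_def chi_mat_def op_mat_carrier)

lemma commutator_carrier [simp]:
  "A \<in> carrier_mat n n \<Longrightarrow> B \<in> carrier_mat n n \<Longrightarrow> commutator A B \<in> carrier_mat n n"
  by (simp add: commutator_def minus_carrier_mat)

lemma w_x_mat_carrier [simp]:
  "w_mat a b \<in> carrier_mat (4 * (a + 1)) (4 * (a + 1))"
  "w'_mat a \<in> carrier_mat (4 * (a + 1)) (4 * (a + 1))"
  "x_mat a \<in> carrier_mat (4 * (a + 1)) (4 * (a + 1))"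
  unfolding w_mat_def w'_mat_def x_mat_def
  by (rule commutator_carrier uminus_carrier_mat rep_mat_carrier)+

section \<open>Affine dependence of the generators on \<open>b\<close>\<close>

lemma y_mat_shift: "y_mat a (b + z) = y_mat a b + z \<cdot>\<^sub>m (2 \<cdot>\<^sub>m 1\<^sub>m (4 * (a + 1)))"
proof (intro eq_matI)
  fix i j assume "i < dim_row (y_mat a b + z \<cdot>\<^sub>m (2 \<cdot>\<^sub>m 1\<^sub>m (4 * (a + 1))))"
    "j < dim_col (y_mat a b + z \<cdot>\<^sub>m (2 \<cdot>\<^sub>m 1\<^sub>m (4 * (a + 1))))"
  then have ij: "i < 4 * (a + 1)" "j < 4 * (a + 1)" by auto
  then have eq: "basis a ! j = basis a ! i \<longleftrightarrow> i = j"
    by (simp only: basis_nth_eq_iff eq_commute)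
  have "y_val a (b + z) x = y_val a b x + 2 * z" for x
    by (cases x) (auto simp: algebra_simps)
  then show "y_mat a (b + z) $$ (i, j) = (y_mat a b + z \<cdot>\<^sub>m (2 \<cdot>\<^sub>m 1\<^sub>m (4 * (a + 1)))) $$ (i, j)"
    using ij eq by (auto simp: y_mat_def op_mat_def split: prod.splits)
qed (auto simp: y_mat_def op_mat_def)

text \<open>All coefficients of \<open>u_act\<close> are affine in \<open>b\<close>, and
  \<open>u'_act\<close> lists their slopes.\<close>

lemma u_mat_shift: "u_mat a (b + z) = u_mat a b + z \<cdot>\<^sub>m u'_mat a"
proof -
  have "(\<Sum>(k, l)\<leftarrow>u_act a (b + z) m. if l = m' then k else 0) =
      (\<Sum>(k, l)\<leftarrow>u_act a b m. if l = m' then k else 0) + z * (\<Sum>(k, l)\<leftarrow>u'_act a m. if l = m' then k else 0)" for m m'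
  proof (cases m)
    case (Pair x n)
    then show ?thesis
      by (cases x) (simp_all add: algebra_simps add_divide_distrib)
  qed
  then show ?thesis
    by (intro eq_matI) (simp_all add: u_mat_def u'_mat_def op_mat_def)
qed

text \<open>The commutator with the fixed matrix \<open>e_mat\<close> is linear, so the shift
  formula passes from \<open>u\<close> to \<open>w\<close>.\<close>

lemma w_mat_shift: "w_mat a (b + z) = w_mat a b + z \<cdot>\<^sub>m w'_mat a"
proof -
  have *: "A * (B + z \<cdot>\<^sub>m C) - (B + z \<cdot>\<^sub>m C) * A = (A * B - B * A) + z \<cdot>\<^sub>m (A * C - C * A)"
    if "A \<in> carrier_mat n n" "B \<in> carrier_mat n n" "C \<in> carrier_mat n n" for A B C :: "complex mat" and n
    using that
    by (intro eq_matI) (auto simp: scalar_prod_def sum.distrib sum_distrib_left algebra_simps)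
  show ?thesis
    unfolding w_mat_def w'_mat_def commutator_def u_mat_shift
    by (rule *) (rule rep_mat_carrier)+
qed

lemma kron_smult_right: "A \<otimes>\<^sub>K (c \<cdot>\<^sub>m B) = c \<cdot>\<^sub>m (A \<otimes>\<^sub>K B)"
proof -
  have "i mod n < n" if "i < m * n" for i m n :: nat
    using that by (cases "n = 0") auto
  then show ?thesis
    by (intro eq_matI) (auto simp: kron_def)
qed

lemma J_subst_irrep:
  "J_subst N (4 * (a + 1)) \<alpha> (\<lambda>z. irrep a (b + z) A) (ngen_rep a b N \<alpha> A)"
proof -
  have "J_subst N (4 * (a + 1)) \<alpha> (\<lambda>z. y_mat a (b + z)) (ngen_rep a b N \<alpha> gY)"
    \<comment> \<open>The factor 2 of \<open>Y\<close> is moved into the right Kronecker factor,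
      where \<open>J_subst_J\<close> can treat it as part of \<open>B\<close>.\<close>
    unfolding y_mat_shift ngen_rep.simps kron_smult_right[symmetric]
    by (rule J_subst_add[OF J_subst_const J_subst_J]; simp only: rep_mat_carrier smult_carrier_mat one_carrier_mat)
  moreover have "J_subst N (4 * (a + 1)) \<alpha> (\<lambda>z. u_mat a (b + z)) (ngen_rep a b N \<alpha> gU)"
    "J_subst N (4 * (a + 1)) \<alpha> (\<lambda>z. w_mat a (b + z)) (ngen_rep a b N \<alpha> gW)"
    unfolding u_mat_shift w_mat_shift ngen_rep.simps
    by (rule J_subst_add[OF J_subst_const J_subst_J]; rule rep_mat_carrier w_x_mat_carrier)+
  ultimately show ?thesis
    by (cases A) (simp_all only: irrep.simps ngen_rep.simps J_subst_const rep_mat_carrier w_x_mat_carrier)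
qed

section \<open>Substitution in the Casimir elements\<close>

text \<open>This and the next two lemmas hold because the Casimir elements are finite sums of words
  with coefficients free of \<open>z\<close>.\<close>

lemma J_subst_casimir2:
  assumes "\<And>A. J_subst N d \<alpha> (\<lambda>z. R z A) (\<rho> A)"
  shows "J_subst N d \<alpha> (\<lambda>z. casimir2 (R z)) (casimir2 \<rho>)"
  unfolding casimir2_def by (intro J_subst_intros assms)

lemma J_subst_casimir3:
  assumes "\<And>A. J_subst N d \<alpha> (\<lambda>z. R z A) (\<rho> A)"
  shows "J_subst N d \<alpha> (\<lambda>z. casimir3 d (R z)) (casimir3 (N * d) \<rho>)"
  unfolding casimir3_def by (intro J_subst_intros; (clarsimp split: prod.splits)?; intro J_subst_intros assms)

lemma J_subst_ghost_casimir:
  assumes "\<And>A. J_subst N d \<alpha> (\<lambda>z. R z A) (\<rho> A)"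
  shows "J_subst N d \<alpha> (\<lambda>z. ghost_casimir d (R z)) (ghost_casimir (N * d) \<rho>)"
  unfolding ghost_casimir_def Let_def by (intro J_subst_intros assms)

section \<open>Matrices acting on row vectors\<close>

definition vanishes_off_basis :: "nat \<Rightarrow> (label \<Rightarrow> complex) \<Rightarrow> bool" where
  "vanishes_off_basis a \<phi> \<longleftrightarrow> (\<forall>l. l \<notin> set (basis a) \<longrightarrow> \<phi> l = 0)"

text \<open>\<open>T\<close> is right multiplication of row vectors by \<open>M\<close>; row vectors are functions on all
  symbols that vanish off the basis.\<close>

definition acts :: "nat \<Rightarrow> complex mat \<Rightarrow> ((label \<Rightarrow> complex) \<Rightarrow> label \<Rightarrow> complex) \<Rightarrow> bool" where
  "acts a M T \<longleftrightarrow> M \<in> carrier_mat (4 * (a + 1)) (4 * (a + 1)) \<and>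
     (\<forall>\<phi>. vanishes_off_basis a \<phi> \<longrightarrow> vanishes_off_basis a (T \<phi>) \<and>
        (\<forall>j<4 * (a + 1). (\<Sum>i<4 * (a + 1). \<phi> (basis a ! i) * M $$ (i, j)) = T \<phi> (basis a ! j)))"

text \<open>The row vector that is 1 at one basis symbol and 0 elsewhere reads off one row of the
  matrix.\<close>

lemma acts_unique:
  assumes "acts a M T" "acts a M' T"
  shows "M = M'"
proof (rule eq_matI)
  fix i j assume "i < dim_row M'" "j < dim_col M'"
  then have ij: "i < 4 * (a + 1)" "j < 4 * (a + 1)"
    using assms(2) by (auto simp: acts_def)
  define \<phi> :: "label \<Rightarrow> complex" where "\<phi> l = (if l = basis a ! i then 1 else 0)" for l
  have "basis a ! i \<in> set (basis a)"
    using ij by (metis length_basis nth_mem)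
  then have \<phi>: "vanishes_off_basis a \<phi>"
    by (auto simp: vanishes_off_basis_def \<phi>_def)
  have "(\<Sum>k<4 * (a + 1). \<phi> (basis a ! k) * X $$ (k, j)) = X $$ (i, j)" for X :: "complex mat"
  proof -
    have "(\<Sum>k<4 * (a + 1). \<phi> (basis a ! k) * X $$ (k, j)) = (\<Sum>k<4 * (a + 1). if k = i then X $$ (k, j) else 0)"
      using ij by (intro sum.cong) (auto simp: \<phi>_def basis_nth_eq_iff)
    then show ?thesis
      using ij by simp
  qed
  then show "M $$ (i, j) = M' $$ (i, j)"
    using assms \<phi> ij unfolding acts_def by metis
qed (use assms in \<open>auto simp: acts_def\<close>)

text \<open>On row vectors the left factor acts first, so each word in the generators reappears
  below with its operators nested in the opposite order.\<close>

lemma acts_mult: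
  assumes "acts a M S" "acts a M' T"
  shows "acts a (M * M') (\<lambda>\<phi>. T (S \<phi>))"
proof -
  let ?n = "4 * (a + 1)"
  have "(\<Sum>i<?n. \<phi> (basis a ! i) * (M * M') $$ (i, j)) = T (S \<phi>) (basis a ! j)"
    if "vanishes_off_basis a \<phi>" "j < ?n" for \<phi> j
  proof -
    have "(\<Sum>i<?n. \<phi> (basis a ! i) * (M * M') $$ (i, j)) =
        (\<Sum>i<?n. \<Sum>k<?n. \<phi> (basis a ! i) * (M $$ (i, k) * M' $$ (k, j)))"
      using assms that by (intro sum.cong) (auto simp: acts_def scalar_prod_def atLeast0LessThan sum_distrib_left)
    also have "\<dots> = (\<Sum>k<?n. (\<Sum>i<?n. \<phi> (basis a ! i) * M $$ (i, k)) * M' $$ (k, j))"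
      by (subst sum.swap) (simp add: sum_distrib_right mult.assoc)
    also have "\<dots> = (\<Sum>k<?n. S \<phi> (basis a ! k) * M' $$ (k, j))"
      using assms(1) that(1) by (intro sum.cong) (auto simp: acts_def)
    also have "\<dots> = T (S \<phi>) (basis a ! j)"
      using assms that by (auto simp: acts_def)
    finally show ?thesis .
  qed
  then show ?thesis
    using assms unfolding acts_def by auto
qed

lemma acts_add:
  assumes "acts a M S" "acts a M' T"
  shows "acts a (M + M') (\<lambda>\<phi> l. S \<phi> l + T \<phi> l)"
proof -
  have "(\<Sum>i<4 * (a + 1). \<phi> (basis a ! i) * (M + M') $$ (i, j)) =
      (\<Sum>i<4 * (a + 1). \<phi> (basis a ! i) * M $$ (i, j)) + (\<Sum>i<4 * (a + 1). \<phi> (basis a ! i) * M' $$ (i, j))"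
    if "j < 4 * (a + 1)" for \<phi> j
    unfolding sum.distrib[symmetric] using assms that
    by (intro sum.cong) (auto simp: acts_def algebra_simps)
  then show ?thesis
    using assms unfolding acts_def vanishes_off_basis_def by auto
qed

lemma acts_smult:
  assumes "acts a M T"
  shows "acts a (c \<cdot>\<^sub>m M) (\<lambda>\<phi> l. c * T \<phi> l)"
proof -
  have "(\<Sum>i<4 * (a + 1). \<phi> (basis a ! i) * (c \<cdot>\<^sub>m M) $$ (i, j)) =
      c * (\<Sum>i<4 * (a + 1). \<phi> (basis a ! i) * M $$ (i, j))" if "j < 4 * (a + 1)" for \<phi> j
    unfolding sum_distrib_left using assms that
    by (intro sum.cong) (auto simp: acts_def algebra_simps)
  then show ?thesis
    using assms unfolding acts_def vanishes_off_basis_def by auto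
qed

lemma acts_uminus:
  assumes "acts a M T"
  shows "acts a (- M) (\<lambda>\<phi> l. - T \<phi> l)"
proof -
  have "- M = (- 1) \<cdot>\<^sub>m M"
    by (intro eq_matI) auto
  then show ?thesis
    using acts_smult[OF assms, of "- 1"] by simp
qed

lemma acts_minus:
  assumes "acts a M S" "acts a M' T"
  shows "acts a (M - M') (\<lambda>\<phi> l. S \<phi> l - T \<phi> l)"
proof -
  have "M - M' = M + - M'"
    using assms by (intro eq_matI) (auto simp: acts_def)
  then show ?thesis
    using acts_add[OF assms(1) acts_uminus[OF assms(2)]] by simp
qed

lemma acts_one: "acts a (1\<^sub>m (4 * (a + 1))) (\<lambda>\<phi>. \<phi>)"
proof -
  have "(\<Sum>i<4 * (a + 1). \<phi> (basis a ! i) * 1\<^sub>m (4 * (a + 1)) $$ (i, j)) = \<phi> (basis a ! j)"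
    if "j < 4 * (a + 1)" for \<phi> :: "label \<Rightarrow> complex" and j
  proof -
    have "(\<Sum>i<4 * (a + 1). \<phi> (basis a ! i) * 1\<^sub>m (4 * (a + 1)) $$ (i, j)) =
        (\<Sum>i<4 * (a + 1). if i = j then \<phi> (basis a ! i) else 0)"
      using that by (intro sum.cong) auto
    then show ?thesis
      using that by simp
  qed
  then show ?thesis
    by (simp add: acts_def)
qed

lemma acts_mat_sum:
  assumes "\<And>x. x \<in> S \<Longrightarrow> acts a (M x) (T x)"
  shows "acts a (mat_sum (4 * (a + 1)) M S) (\<lambda>\<phi> l. \<Sum>x\<in>S. T x \<phi> l)"
proof -
  have "(\<Sum>i<4 * (a + 1). \<phi> (basis a ! i) * mat_sum (4 * (a + 1)) M S $$ (i, j)) =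
      (\<Sum>x\<in>S. T x \<phi> (basis a ! j))" if "vanishes_off_basis a \<phi>" "j < 4 * (a + 1)" for \<phi> j
  proof -
    have "(\<Sum>i<4 * (a + 1). \<phi> (basis a ! i) * mat_sum (4 * (a + 1)) M S $$ (i, j)) =
        (\<Sum>x\<in>S. \<Sum>i<4 * (a + 1). \<phi> (basis a ! i) * M x $$ (i, j))"
      using that by (subst sum.swap) (auto simp: mat_sum_def sum_distrib_left intro!: sum.cong)
    also have "\<dots> = (\<Sum>x\<in>S. T x \<phi> (basis a ! j))"
      using that assms by (intro sum.cong) (auto simp: acts_def)
    finally show ?thesis .
  qed
  moreover have "vanishes_off_basis a (\<lambda>l. \<Sum>x\<in>S. T x \<phi> l)" if "vanishes_off_basis a \<phi>" for \<phi>
    using assms that by (auto simp: acts_def vanishes_off_basis_def intro!: sum.neutral)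
  ultimately show ?thesis
    by (auto simp: acts_def mat_sum_def)
qed

lemmas acts_intros =
  acts_add acts_minus acts_uminus acts_smult acts_mult acts_one acts_mat_sum

section \<open>Operators prescribed on symbols\<close>

text \<open>A row vector is read as a linear functional on the span of the symbols, and
  \<open>pull act\<close> composes it with the operator described by \<open>act\<close>.\<close>

definition pull :: "(label \<Rightarrow> (complex \<times> label) list) \<Rightarrow> (label \<Rightarrow> complex) \<Rightarrow> label \<Rightarrow> complex" where
  "pull act \<phi> l = (\<Sum>(k, l') \<leftarrow> act l. k * \<phi> l')"

text \<open>The assumption says that the span of the symbols outside the basis is invariant, so that
  dropping these symbols is compatible with composition.\<close>

lemma acts_op_mat:
  assumes "\<And>\<phi> l. vanishes_off_basis a \<phi> \<Longrightarrow> l \<notin> set (basis a) \<Longrightarrow> pull act \<phi> l = 0"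
  shows "acts a (op_mat a act) (pull act)"
proof -
  have inner: "(\<Sum>i<4 * (a + 1). \<phi> (basis a ! i) * (\<Sum>(k, l) \<leftarrow> xs. if l = basis a ! i then k else 0)) =
      (\<Sum>(k, l) \<leftarrow> xs. k * \<phi> l)" if \<phi>: "vanishes_off_basis a \<phi>" for \<phi> xs
  proof (induction xs)
    case (Cons x xs)
    obtain k l where x: "x = (k, l)" by (cases x)
    \<comment> \<open>A basis symbol \<open>l\<close> is hit by exactly one \<open>i\<close>. For
      any other \<open>l\<close> both sides are 0, the right one because \<open>\<phi>\<close>
      vanishes there.\<close>
    have "(\<Sum>i<4 * (a + 1). \<phi> (basis a ! i) * (if l = basis a ! i then k else 0)) = k * \<phi> l"
    proof (cases "l \<in> set (basis a)")
      case True
      then obtain i where i: "i < 4 * (a + 1)" "l = basis a ! i"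
        by (metis in_set_conv_nth length_basis)
      have "(\<Sum>j<4 * (a + 1). \<phi> (basis a ! j) * (if l = basis a ! j then k else 0)) =
          (\<Sum>j<4 * (a + 1). if j = i then k * \<phi> l else 0)"
        using i by (intro sum.cong) (auto simp: basis_nth_eq_iff)
      then show ?thesis
        using i by simp
    next
      case False
      then have "l \<noteq> basis a ! i" if "i < 4 * (a + 1)" for i
        using that by (metis length_basis nth_mem)
      moreover have "\<phi> l = 0"
        using False \<phi> unfolding vanishes_off_basis_def by blast
      ultimately show ?thesis
        by (auto intro!: sum.neutral)
    qed
    then show ?case
      using Cons.IH by (simp add: x distrib_left sum.distrib)
  qed simp
  have "(\<Sum>i<4 * (a + 1). \<phi> (basis a ! i) * op_mat a act $$ (i, j)) = pull act \<phi> (basis a ! j)"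
    if "vanishes_off_basis a \<phi>" "j < 4 * (a + 1)" for \<phi> j
    unfolding pull_def inner[OF that(1), symmetric] using that(2)
    by (intro sum.cong) (auto simp: op_mat_def)
  moreover have "vanishes_off_basis a (pull act \<phi>)" if "vanishes_off_basis a \<phi>" for \<phi>
    using assms[OF that] by (simp add: vanishes_off_basis_def[of a "pull act \<phi>"])
  ultimately show ?thesis
    using op_mat_carrier unfolding acts_def by blast
qed

text \<open>The first exponent out of range, which is also the number of basis symbols in the
  sector.\<close>

fun top_index :: "nat \<Rightarrow> sector \<Rightarrow> nat" where
  "top_index a Lam = a + 1"
| "top_index a VLam = a + 2"
| "top_index a Omega = a"
| "top_index a VFVLam = a + 1"

lemma in_basis_iff: "(x, n) \<in> set (basis a) \<longleftrightarrow> n < top_index a x"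
  by (cases x) (auto simp: basis_def)

lemma vanishes_off_basisD: "vanishes_off_basis a \<phi> \<Longrightarrow> top_index a x \<le> n \<Longrightarrow> \<phi> (x, n) = 0"
  by (auto simp: vanishes_off_basis_def in_basis_iff)

text \<open>The clauses for \<open>gW\<close> and \<open>gX\<close> are the defining commutators
  worked out by hand; \<open>acts_irrep\<close> confirms them.\<close>

fun row_act :: "nat \<Rightarrow> complex \<Rightarrow> gen \<Rightarrow> label \<Rightarrow> (complex \<times> label) list" where
  "row_act a b gF (x, n) = [(1, (x, n + 1))]"
| "row_act a b gH (x, n) = [(c_val a x - 2 * of_nat n, (x, n))]"
| "row_act a b gE (x, n) = [(of_nat n * (c_val a x - of_nat n + 1), (x, n - 1))]"
| "row_act a b gY (x, n) = [(y_val a b x, (x, n))]"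
| "row_act a b gU l = u_act a b l"
| "row_act a b gV l = v_act a l"
| "row_act a b gW (Lam, n) = []"
| "row_act a b gW (VLam, n) = [(- b * of_nat n, (Lam, n - 1))]"
| "row_act a b gW (Omega, n) = [((of_nat a + 1 - b) * (of_nat a - of_nat n), (Lam, n))]"
| "row_act a b gW (VFVLam, n) =
     [((b / (of_nat a + 1) - 1) * (of_nat a + 1 - of_nat n), (VLam, n)),
      (- (b / (of_nat a + 1)) * of_nat n, (Omega, n - 1))]"
| "row_act a b gX (Lam, n) =
     [(- 1 / (of_nat a + 1), (VLam, n + 1)), (- 1 / (of_nat a + 1), (Omega, n))]"
| "row_act a b gX (VLam, n) = [(1, (VFVLam, n))]"
| "row_act a b gX (Omega, n) = [(- 1, (VFVLam, n + 1))]"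
| "row_act a b gX (VFVLam, n) = []"

abbreviation row_op :: "nat \<Rightarrow> complex \<Rightarrow> gen \<Rightarrow> (label \<Rightarrow> complex) \<Rightarrow> label \<Rightarrow> complex" where
  "row_op a b A \<equiv> pull (row_act a b A)"

lemma acts_basic:
  "acts a (f_mat a) (row_op a b gF)"
  "acts a (h_mat a) (row_op a b gH)"
  "acts a (e_mat a) (row_op a b gE)"
  "acts a (y_mat a b) (row_op a b gY)"
  "acts a (u_mat a b) (row_op a b gU)"
  "acts a (v_mat a) (row_op a b gV)"
proof -
  have *: "acts a (op_mat a act) (row_op a b A)"
    if "\<And>\<phi> x n. vanishes_off_basis a \<phi> \<Longrightarrow> top_index a x \<le> n \<Longrightarrow> row_op a b A \<phi> (x, n) = 0" "act = row_act a b A"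
    for act A
    unfolding that(2) using that(1) by (intro acts_op_mat) (auto simp: in_basis_iff)
  \<comment> \<open>Beyond the first exponent out of range all image symbols are out of range too.
    At that exponent itself \<open>e\<close> and \<open>v\<close> may lead back into the basis, but
    then with coefficient 0.\<close>
  have edge: "n = m \<or> m + 1 \<le> n" if "m \<le> n" for m n :: nat
    using that by auto
  show "acts a (f_mat a) (row_op a b gF)"
    unfolding f_mat_def by (rule *) (auto simp: pull_def vanishes_off_basisD)
  show "acts a (h_mat a) (row_op a b gH)"
    unfolding h_mat_def by (rule *) (auto simp: pull_def vanishes_off_basisD)
  show "acts a (y_mat a b) (row_op a b gY)"
    unfolding y_mat_def by (rule *) (auto simp: pull_def vanishes_off_basisD)
  show "acts a (e_mat a) (row_op a b gE)"
    unfolding e_mat_def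
  proof (rule *)
    fix \<phi> x n assume \<phi>: "vanishes_off_basis a \<phi>" "top_index a x \<le> n"
    show "row_op a b gE \<phi> (x, n) = 0"
      using edge[OF \<phi>(2)] \<phi>(1) by (cases x) (auto simp: pull_def vanishes_off_basisD)
  qed auto
  show "acts a (u_mat a b) (row_op a b gU)"
    unfolding u_mat_def
  proof (rule *)
    fix \<phi> x n assume \<phi>: "vanishes_off_basis a \<phi>" "top_index a x \<le> n"
    then show "row_op a b gU \<phi> (x, n) = 0"
      by (cases x) (auto simp: pull_def vanishes_off_basisD)
  qed auto
  show "acts a (v_mat a) (row_op a b gV)"
    unfolding v_mat_def
  proof (rule *)
    fix \<phi> x n assume \<phi>: "vanishes_off_basis a \<phi>" "top_index a x \<le> n"
    \<comment> \<open>Needed for \<open>1 - n / (a + 1)\<close> to vanish at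
      \<open>n = a + 1\<close>.\<close>
    have "of_nat a + 1 \<noteq> (0 :: complex)"
      by (metis of_nat_Suc of_nat_neq_0 add.commute)
    then show "row_op a b gV \<phi> (x, n) = 0"
      using edge[OF \<phi>(2)] \<phi>(1) by (cases x) (auto simp: pull_def vanishes_off_basisD add.commute)
  qed auto
qed

text \<open>With \<open>c = a + 1\<close> as the variable, every denominator is a single nonzero
  symbol that the simplifier can clear.\<close>

lemma of_nat_eq_minus_1:
  obtains c :: complex where "of_nat a = c - 1" "c \<noteq> 0"
  by (rule that[of "of_nat (Suc a)"]) (simp, rule of_nat_neq_0)

lemma acts_irrep: "acts a (irrep a b A) (row_op a b A)"
proof -
  obtain c :: complex where c: "of_nat a = c - 1" "c \<noteq> 0"
    by (rule of_nat_eq_minus_1)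
  have "acts a (w_mat a b) (\<lambda>\<phi> l. row_op a b gU (row_op a b gE \<phi>) l - row_op a b gE (row_op a b gU \<phi>) l)"
    unfolding w_mat_def commutator_def by (intro acts_intros acts_basic)
  also have "(\<lambda>\<phi> l. row_op a b gU (row_op a b gE \<phi>) l - row_op a b gE (row_op a b gU \<phi>) l) = row_op a b gW"
  proof (intro ext)
    fix \<phi> :: "label \<Rightarrow> complex" and l :: label
    obtain x n where l: "l = (x, n)" by (cases l)
    show "row_op a b gU (row_op a b gE \<phi>) l - row_op a b gE (row_op a b gU \<phi>) l = row_op a b gW \<phi> l"
      \<comment> \<open>The case \<open>n = 0\<close> is separated because \<open>n - 1\<close> is
        truncated. The identity holds on all symbols, inside the basis or not.\<close>
      unfolding l by (cases x; cases n) (simp_all add: pull_def c field_simps)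
  qed
  finally have w: "acts a (w_mat a b) (row_op a b gW)" .
  have "acts a (x_mat a) (\<lambda>\<phi> l. - (row_op a b gV (row_op a b gF \<phi>) l - row_op a b gF (row_op a b gV \<phi>) l))"
    unfolding x_mat_def commutator_def by (intro acts_intros acts_basic)
  also have "(\<lambda>\<phi> l. - (row_op a b gV (row_op a b gF \<phi>) l - row_op a b gF (row_op a b gV \<phi>) l)) = row_op a b gX"
  proof (intro ext)
    fix \<phi> :: "label \<Rightarrow> complex" and l :: label
    obtain x n where l: "l = (x, n)" by (cases l)
    show "- (row_op a b gV (row_op a b gF \<phi>) l - row_op a b gF (row_op a b gV \<phi>) l) = row_op a b gX \<phi> l"
      unfolding l by (cases x; cases n) (simp_all add: pull_def c field_simps)
  qed
  finally have x: "acts a (x_mat a) (row_op a b gX)" .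
  show ?thesis
    using acts_basic w x by (cases A) simp_all
qed

lemma acts_chi: "acts a (chi_mat a) (\<lambda>\<phi> (x, n). (if x = Lam \<or> x = VFVLam then 1 else - 1) * \<phi> (x, n))"
proof -
  have "(\<lambda>\<phi> (x, n). (if x = Lam \<or> x = VFVLam then 1 else - 1) * \<phi> (x, n)) =
      pull (\<lambda>(x, n). [(if x = Lam \<or> x = VFVLam then 1 else - 1, (x, n))])"
    by (auto simp: pull_def fun_eq_iff)
  then show ?thesis
    unfolding chi_mat_def by (auto intro!: acts_op_mat simp: pull_def vanishes_off_basis_def)
qed

section \<open>The Casimir elements on R(a,b)\<close>

text \<open>In the basis where \<open>F\<^sup>n\<omega>\<close> is replaced by \<open>- F\<^sup>nX\<Lambda> = (F\<^sup>n\<^sup>+\<^sup>1V\<Lambda> + F\<^sup>n\<omega>) / c\<close>, with \<open>c = a + 1\<close>, the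
  action has no denominators. That vector is encoded by the label \<open>(Omega, n)\<close>.\<close>

fun kac_act :: "complex \<Rightarrow> complex \<Rightarrow> gen \<Rightarrow> (label \<Rightarrow> complex) \<Rightarrow> label \<Rightarrow> complex" where
  "kac_act c b gF \<psi> (x, n) = \<psi> (x, n + 1)"
| "kac_act c b gH \<psi> (Lam, n) = (c - 1 - 2 * of_nat n) * \<psi> (Lam, n)"
| "kac_act c b gH \<psi> (VLam, n) = (c - 2 * of_nat n) * \<psi> (VLam, n)"
| "kac_act c b gH \<psi> (Omega, n) = (c - 2 - 2 * of_nat n) * \<psi> (Omega, n)"
| "kac_act c b gH \<psi> (VFVLam, n) = (c - 1 - 2 * of_nat n) * \<psi> (VFVLam, n)"
| "kac_act c b gE \<psi> (Lam, n) = of_nat n * (c - of_nat n) * \<psi> (Lam, n - 1)"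
| "kac_act c b gE \<psi> (VLam, n) = of_nat n * (c + 1 - of_nat n) * \<psi> (VLam, n - 1)"
| "kac_act c b gE \<psi> (Omega, n) =
     \<psi> (VLam, n) + of_nat n * (c - 1 - of_nat n) * \<psi> (Omega, n - 1)"
| "kac_act c b gE \<psi> (VFVLam, n) = of_nat n * (c - of_nat n) * \<psi> (VFVLam, n - 1)"
| "kac_act c b gY \<psi> (Lam, n) = (2 * b - c + 1) * \<psi> (Lam, n)"
| "kac_act c b gY \<psi> (VLam, n) = (2 * b - c) * \<psi> (VLam, n)"
| "kac_act c b gY \<psi> (Omega, n) = (2 * b - c) * \<psi> (Omega, n)"
| "kac_act c b gY \<psi> (VFVLam, n) = (2 * b - c - 1) * \<psi> (VFVLam, n)"
| "kac_act c b gU \<psi> (Lam, n) = 0"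
| "kac_act c b gU \<psi> (VLam, n) = b * \<psi> (Lam, n)"
| "kac_act c b gU \<psi> (Omega, n) = \<psi> (Lam, n + 1)"
| "kac_act c b gU \<psi> (VFVLam, n) = b * \<psi> (Omega, n) - \<psi> (VLam, n + 1)"
| "kac_act c b gV \<psi> (Lam, n) = \<psi> (VLam, n) - of_nat n * \<psi> (Omega, n - 1)"
| "kac_act c b gV \<psi> (VLam, n) = of_nat n * \<psi> (VFVLam, n - 1)"
| "kac_act c b gV \<psi> (Omega, n) = \<psi> (VFVLam, n)"
| "kac_act c b gV \<psi> (VFVLam, n) = 0"
| "kac_act c b gW \<psi> (Lam, n) = 0"
| "kac_act c b gW \<psi> (VLam, n) = - b * of_nat n * \<psi> (Lam, n - 1)"
| "kac_act c b gW \<psi> (Omega, n) = (c - 1 - of_nat n - b) * \<psi> (Lam, n)"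
| "kac_act c b gW \<psi> (VFVLam, n) =
     (b - c + of_nat n) * \<psi> (VLam, n) - b * of_nat n * \<psi> (Omega, n - 1)"
| "kac_act c b gX \<psi> (Lam, n) = - \<psi> (Omega, n)"
| "kac_act c b gX \<psi> (VLam, n) = \<psi> (VFVLam, n)"
| "kac_act c b gX \<psi> (Omega, n) = 0"
| "kac_act c b gX \<psi> (VFVLam, n) = 0"

text \<open>The values of the functional \<open>\<phi>\<close> on the new vectors;
  \<open>unkac\<close> recovers its values on the old ones.\<close>

fun kac :: "complex \<Rightarrow> (label \<Rightarrow> complex) \<Rightarrow> label \<Rightarrow> complex" where
  "kac c \<phi> (Omega, n) = (\<phi> (VLam, n + 1) + \<phi> (Omega, n)) / c"
| "kac c \<phi> (x, n) = \<phi> (x, n)"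

fun unkac :: "complex \<Rightarrow> (label \<Rightarrow> complex) \<Rightarrow> label \<Rightarrow> complex" where
  "unkac c \<psi> (Omega, n) = c * \<psi> (Omega, n) - \<psi> (VLam, n + 1)"
| "unkac c \<psi> (x, n) = \<psi> (x, n)"

lemma unkac_kac:
  assumes "c \<noteq> 0"
  shows "unkac c (kac c \<phi>) = \<phi>"
proof
  fix l show "unkac c (kac c \<phi>) l = \<phi> l"
    using assms by (cases "(c, \<phi>, l)" rule: kac.cases) simp_all
qed

text \<open>Moves \<open>unkac\<close> to the outside of any word in the generators. As every row
  vector has the form \<open>unkac c \<psi>\<close>, the Casimir identities become computations with
  \<open>kac_act\<close>, free of division by \<open>c\<close>.\<close>

lemma row_op_unkac:
  assumes "of_nat a = c - 1" "c \<noteq> 0"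
  shows "row_op a b A (unkac c \<psi>) = unkac c (kac_act c b A \<psi>)"
proof
  fix l :: label
  obtain x n where l: "l = (x, n)" by (cases l)
  show "row_op a b A (unkac c \<psi>) l = unkac c (kac_act c b A \<psi>) l"
    unfolding l using assms(2)
    by (cases A; cases x; cases n) (simp_all add: pull_def assms(1) field_simps)
qed

section \<open>The quadratic Casimir element\<close>

lemma row_casimir2:
  "- 1 / 4 * (row_op a b gH (row_op a b gH \<phi>) l - row_op a b gY (row_op a b gY \<phi>) l
      + 2 * (row_op a b gF (row_op a b gE \<phi>) l + row_op a b gE (row_op a b gF \<phi>) l)
      + 2 * (row_op a b gV (row_op a b gU \<phi>) l - row_op a b gU (row_op a b gV \<phi>) l)
      + 2 * (row_op a b gX (row_op a b gW \<phi>) l - row_op a b gW (row_op a b gX \<phi>) l)) =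
    b * (b - of_nat a - 1) * \<phi> l"
proof -
  obtain c :: complex where c: "of_nat a = c - 1" "c \<noteq> 0"
    by (rule of_nat_eq_minus_1)
  obtain \<psi> where \<phi>: "\<phi> = unkac c \<psi>"
    using unkac_kac[OF c(2)] by metis
  obtain x n where l: "l = (x, n)" by (cases l)
  show ?thesis
    \<comment> \<open>Only \<open>E\<close>, \<open>V\<close> and \<open>W\<close> lower an
      exponent, and each product here contains at most one of them, so splitting off
      \<open>n = 0\<close> resolves \<open>n - 1\<close>.\<close>
    unfolding l \<phi> row_op_unkac[OF c] c(1) by (cases x; cases n) (simp_all add: algebra_simps)
qed

lemma casimir2_irrep:
  "casimir2 (irrep a b) = (b * (b - of_nat a - 1)) \<cdot>\<^sub>m 1\<^sub>m (4 * (a + 1))"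
proof (rule acts_unique)
  show "acts a (casimir2 (irrep a b)) (\<lambda>\<phi> l. b * (b - of_nat a - 1) * \<phi> l)"
    unfolding row_casimir2[symmetric] casimir2_def
    by (intro acts_intros acts_irrep)
  show "acts a ((b * (b - of_nat a - 1)) \<cdot>\<^sub>m 1\<^sub>m (4 * (a + 1))) (\<lambda>\<phi> l. b * (b - of_nat a - 1) * \<phi> l)"
    by (intro acts_intros)
qed

section \<open>The ghost Casimir element\<close>

text \<open>Peeling off one point at a time writes each permutation as a product of transpositions,
  which gives its sign.\<close>

lemma sum_sign_permutes_4:
  fixes h :: "nat \<Rightarrow> nat \<Rightarrow> nat \<Rightarrow> nat \<Rightarrow> 'a::comm_ring_1"
  shows "(\<Sum>\<sigma> | \<sigma> permutes {0..<4}. of_int (sign \<sigma>) * h (\<sigma> 0) (\<sigma> 1) (\<sigma> 2) (\<sigma> 3)) =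
     h 0 1 2 3 - h 0 1 3 2 - h 0 2 1 3 + h 0 2 3 1 + h 0 3 1 2 - h 0 3 2 1 - h 1 0 2 3 + h 1
     0 3 2 + h 1 2 0 3 - h 1 2 3 0 - h 1 3 0 2 + h 1 3 2 0 + h 2 0 1 3 - h 2 0 3 1 - h 2 1 0
     3 + h 2 1 3 0 + h 2 3 0 1 - h 2 3 1 0 - h 3 0 1 2 + h 3 0 2 1 + h 3 1 0 2 - h 3 1 2 0 -
     h 3 2 0 1 + h 3 2 1 0"
proof -
  have set: "{0..<4} = {0, 1, 2, 3::nat}"
    by auto
  have fin: "finite {1, 2, 3::nat}" "0 \<notin> {1, 2, 3::nat}" "finite {2, 3::nat}" "1 \<notin> {2, 3::nat}"
    "finite {3::nat}" "2 \<notin> {3::nat}"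
    by auto
  show ?thesis
    unfolding set sum_over_permutations_insert[OF fin(1,2)] sum_over_permutations_insert[OF fin(3,4)]
      sum_over_permutations_insert[OF fin(5,6)] permutes_sing
    by (simp add: sign_swap_id permutation_swap_id permutation_compose sign_compose sign_id transpose_def)
qed

lemma row_ghost_casimir:
  "1 / 6 * (- (row_op a b gV (row_op a b gU \<phi>) (x, n) - row_op a b gU (row_op a b gV \<phi>) (x, n))
      - (row_op a b gX (row_op a b gW \<phi>) (x, n) - row_op a b gW (row_op a b gX \<phi>) (x, n))
      + (\<Sum>\<sigma> | \<sigma> permutes {0..<4}. of_int (sign \<sigma>) *
          row_op a b ([gU, gV, gW, gX] ! \<sigma> 3) (row_op a b ([gU, gV, gW, gX] ! \<sigma> 2)
            (row_op a b ([gU, gV, gW, gX] ! \<sigma> 1) (row_op a b ([gU, gV, gW, gX] ! \<sigma> 0) \<phi>))) (x, n))) =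
    b * (b - of_nat a - 1) * ((if x = Lam \<or> x = VFVLam then 1 else - 1) * \<phi> (x, n))"
proof -
  obtain c :: complex where c: "of_nat a = c - 1" "c \<noteq> 0"
    by (rule of_nat_eq_minus_1)
  obtain \<psi> where \<phi>: "\<phi> = unkac c \<psi>"
    using unkac_kac[OF c(2)] by metis
  \<comment> \<open>The quartic words contain both \<open>V\<close> and \<open>W\<close>, so an
    exponent can drop by 2.\<close>
  consider "n = 0" | "n = 1" | m where "n = Suc (Suc m)"
    by (metis One_nat_def not0_implies_Suc)
  then show ?thesis
    unfolding sum_sign_permutes_4[of "\<lambda>i j k l. row_op a b ([gU, gV, gW, gX] ! l) (row_op a b ([gU, gV, gW, gX] ! k)
            (row_op a b ([gU, gV, gW, gX] ! j) (row_op a b ([gU, gV, gW, gX] ! i) \<phi>))) (x, n)"]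
    unfolding \<phi> row_op_unkac[OF c] c(1)
    by cases (cases x; simp; simp add: algebra_simps)+
qed

subsection \<open>The structure constants of the cubic Casimir element\<close>

text \<open>Naming all nine entries turns products and supertraces into plain rewriting.\<close>

definition mat3 :: "complex \<Rightarrow> complex \<Rightarrow> complex \<Rightarrow> complex \<Rightarrow> complex \<Rightarrow> complex \<Rightarrow> complex \<Rightarrow> complex \<Rightarrow>
    complex \<Rightarrow> complex mat" where
  "mat3 a b c d e f g h i = mat 3 3 (\<lambda>(k, l). [[a, b, c], [d, e, f], [g, h, i]] ! k ! l)"

lemma less_3_iff: "(k :: nat) < 3 \<longleftrightarrow> k = 0 \<or> k = 1 \<or> k = 2"
  by auto

lemma all_less_3: "(\<forall>k<3. P k) \<longleftrightarrow> P 0 \<and> P 1 \<and> P (2 :: nat)"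
  by (auto simp: less_3_iff)

lemma mat3_index [simp]:
  "mat3 a b c d e f g h i $$ (0, 0) = a" "mat3 a b c d e f g h i $$ (0, 1) = b"
  "mat3 a b c d e f g h i $$ (0, Suc 0) = b" "mat3 a b c d e f g h i $$ (0, 2) = c"
  "mat3 a b c d e f g h i $$ (1, 0) = d" "mat3 a b c d e f g h i $$ (1, 1) = e"
  "mat3 a b c d e f g h i $$ (1, 2) = f" "mat3 a b c d e f g h i $$ (Suc 0, 0) = d"
  "mat3 a b c d e f g h i $$ (Suc 0, Suc 0) = e" "mat3 a b c d e f g h i $$ (Suc 0, 2) = f"
  "mat3 a b c d e f g h i $$ (2, 0) = g" "mat3 a b c d e f g h i $$ (2, 1) = h"
  "mat3 a b c d e f g h i $$ (2, Suc 0) = h" "mat3 a b c d e f g h i $$ (2, 2) = i"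
  by (simp_all add: mat3_def)

lemma mat3_carrier [simp]: "mat3 a b c d e f g h i \<in> carrier_mat 3 3"
  by (simp add: mat3_def)

lemma mat3_eqI:
  assumes "M \<in> carrier_mat 3 3" "\<forall>k<3. \<forall>l<3. M $$ (k, l) = mat3 a b c d e f g h i $$ (k, l)"
  shows "M = mat3 a b c d e f g h i"
proof (rule eq_matI)
  fix k l assume "k < dim_row (mat3 a b c d e f g h i)" "l < dim_col (mat3 a b c d e f g h i)"
  then show "M $$ (k, l) = mat3 a b c d e f g h i $$ (k, l)"
    using assms(2) by (simp only: carrier_matD[OF mat3_carrier])
qed (simp_all only: carrier_matD[OF assms(1)] carrier_matD[OF mat3_carrier])

lemma mat3_mult:
  "mat3 a b c d e f g h i * mat3 a' b' c' d' e' f' g' h' i' =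
   mat3 (a * a' + b * d' + c * g') (a * b' + b * e' + c * h') (a * c' + b * f' + c * i')
     (d * a' + e * d' + f * g') (d * b' + e * e' + f * h') (d * c' + e * f' + f * i')
     (g * a' + h * d' + i * g') (g * b' + h * e' + i * h') (g * c' + h * f' + i * i')"
proof (rule mat3_eqI)
  have "{0..<3} = {0, 1, 2 :: nat}"
    by auto
  moreover have "dim_row (mat3 a b c d e f g h i) = 3" "dim_col (mat3 a b c d e f g h i) = 3"
    for a b c d e f g h i
    by (simp_all add: mat3_def)
  ultimately show "\<forall>k<3. \<forall>l<3. (mat3 a b c d e f g h i * mat3 a' b' c' d' e' f' g' h' i') $$ (k, l) =
      mat3 (a * a' + b * d' + c * g') (a * b' + b * e' + c * h') (a * c' + b * f' + c * i')
        (d * a' + e * d' + f * g') (d * b' + e * e' + f * h') (d * c' + e * f' + f * i')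
        (g * a' + h * d' + i * g') (g * b' + h * e' + i * h') (g * c' + h * f' + i * i') $$ (k, l)"
    unfolding all_less_3 by (simp add: scalar_prod_def add.assoc)
qed (rule mult_carrier_mat[OF mat3_carrier mat3_carrier])

lemma mat3_add:
  "mat3 a b c d e f g h i + mat3 a' b' c' d' e' f' g' h' i' =
   mat3 (a + a') (b + b') (c + c') (d + d') (e + e') (f + f') (g + g') (h + h') (i + i')"
  by (rule mat3_eqI) (simp_all add: all_less_3 index_add_mat carrier_matD[OF mat3_carrier])

lemma mat3_smult:
  "x \<cdot>\<^sub>m mat3 a b c d e f g h i = mat3 (x * a) (x * b) (x * c) (x * d) (x * e) (x * f) (x * g) (x * h) (x * i)"
  by (rule mat3_eqI) (simp_all add: all_less_3 carrier_matD[OF mat3_carrier])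

lemma parity_mat3:
  "parity (mat3 a b c d e f g h i) = (if a = 0 \<and> b = 0 \<and> d = 0 \<and> e = 0 \<and> i = 0 then 1 else 0)"
  unfolding parity_def all_less_3 by (auto simp del: One_nat_def)

text \<open>By \<open>dual_basis_unique\<close> it suffices to check the eight pairings, listed in
  \<open>g_form_fund\<close>, and the vanishing supertrace.\<close>

lemma dual_basis_eq:
  "dual_basis A = (let \<delta> = (\<lambda>B. if A = B then 1 else 0) in
     mat3 ((- \<delta> gY - \<delta> gH) / 2) (- \<delta> gF) (- \<delta> gX)
       (- \<delta> gE) ((\<delta> gH - \<delta> gY) / 2) (- \<delta> gV)
       (- \<delta> gW) (- \<delta> gU) (- \<delta> gY))"
  unfolding dual_basis_def Let_def
proof (rule the1_equality[OF dual_basis_unique], intro conjI allI)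
  fix B
  show "g_form (mat3 ((- (if A = gY then 1 else 0) - (if A = gH then 1 else 0)) / 2)
      (- (if A = gF then 1 else 0)) (- (if A = gX then 1 else 0)) (- (if A = gE then 1 else 0))
      (((if A = gH then 1 else 0) - (if A = gY then 1 else 0)) / 2) (- (if A = gV then 1 else 0))
      (- (if A = gW then 1 else 0)) (- (if A = gU then 1 else 0)) (- (if A = gY then 1 else 0))) (fund B) =
    (if A = B then 1 else 0)"
    by (cases B) (simp_all only: g_form_fund[OF mat3_carrier] mat3_index, auto)
qed (auto simp: sl21_def str_def)

lemma sum_gens: "(\<Sum>A\<in>gens. f A) = f gF + f gH + f gE + f gY + f gU + f gV + f gW + f gX"
  for f :: "gen \<Rightarrow> complex"
  by (simp add: gens_def add.assoc)

text \<open>Of the 512 words 46 have a nonzero coefficient. Leaving \<open>G\<close> arbitrary keeps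
  the structure constants apart from the representation.\<close>

lemma sum_f3:
  "(\<Sum>(A, B, C)\<in>gens \<times> gens \<times> gens. f3 (dual_basis C) (dual_basis B) (dual_basis A) * G A B C) =
      1 / 2 * (- G gE gU gX + G gE gX gU - G gU gE gX - G gU gX gE + G gX gE gU + G gX gU gE - G
      gE gF gY - G gE gY gF - G gF gE gY - G gF gY gE - G gY gE gF - G gY gF gE + G gF gV gW - G
      gF gW gV + G gV gF gW + G gV gW gF - G gW gF gV - G gW gV gF) + 1 / 4 * (- G gH gH gY - G gH
      gY gH - G gY gH gH + G gH gU gV - G gH gV gU + G gU gH gV + G gU gV gH - G gV gH gU - G gV
      gU gH - G gH gW gX + G gH gX gW - G gW gH gX - G gW gX gH + G gX gH gW + G gX gW gH) + 3 / 4
      * (- G gU gV gY - G gU gY gV + G gV gU gY + G gV gY gU - G gY gU gV + G gY gV gU - G gW gX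
      gY - G gW gY gX + G gX gW gY + G gX gY gW - G gY gW gX + G gY gX gW + G gY gY gY)"
  unfolding sum.cartesian_product[symmetric] sum_gens
  by (simp add: dual_basis_eq f3_def parity_mat3 mat3_mult mat3_add mat3_smult str_def; simp add: field_simps)

section \<open>The cubic Casimir element, and the matrix forms of the ghost and cubic
  elements\<close>

lemma row_casimir3:
  "1 / 6 * (\<Sum>(A, B, C)\<in>gens \<times> gens \<times> gens. f3 (dual_basis C) (dual_basis B) (dual_basis A) *
      row_op a b C (row_op a b B (row_op a b A \<phi>)) l) =
    1 / 2 * b * (b - of_nat a - 1) * (2 * b - of_nat a - 1) * \<phi> l"
proof -
  obtain c :: complex where c: "of_nat a = c - 1" "c \<noteq> 0"
    by (rule of_nat_eq_minus_1)
  obtain \<psi> where \<phi>: "\<phi> = unkac c \<psi>"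
    using unkac_kac[OF c(2)] by metis
  obtain x n where l: "l = (x, n)" by (cases l)
  \<comment> \<open>The words in \<open>F\<close>, \<open>V\<close>, \<open>W\<close> can lower an
    exponent twice.\<close>
  consider "n = 0" | "n = 1" | m where "n = Suc (Suc m)"
    by (metis One_nat_def not0_implies_Suc)
  then show ?thesis
    unfolding sum_f3[of "\<lambda>A B C. row_op a b C (row_op a b B (row_op a b A \<phi>)) l"]
    unfolding l \<phi> row_op_unkac[OF c] c(1)
    by cases (cases x; simp; simp add: field_simps)+
qed

lemma ghost_casimir_irrep:
  "ghost_casimir (4 * (a + 1)) (irrep a b) = (b * (b - of_nat a - 1)) \<cdot>\<^sub>m chi_mat a"
proof (rule acts_unique)
  let ?T = "\<lambda>\<phi> l. b * (b - of_nat a - 1) *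
    (case l of (x, n) \<Rightarrow> (if x = Lam \<or> x = VFVLam then 1 else - 1) * \<phi> (x, n))"
  have "acts a (ghost_casimir (4 * (a + 1)) (irrep a b)) (\<lambda>\<phi> l.
      1 / 6 * (- (row_op a b gV (row_op a b gU \<phi>) l - row_op a b gU (row_op a b gV \<phi>) l)
      - (row_op a b gX (row_op a b gW \<phi>) l - row_op a b gW (row_op a b gX \<phi>) l)
      + (\<Sum>\<sigma> | \<sigma> permutes {0..<4}. of_int (sign \<sigma>) *
          row_op a b ([gU, gV, gW, gX] ! \<sigma> 3) (row_op a b ([gU, gV, gW, gX] ! \<sigma> 2)
            (row_op a b ([gU, gV, gW, gX] ! \<sigma> 1) (row_op a b ([gU, gV, gW, gX] ! \<sigma> 0) \<phi>))) l)))"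
    unfolding ghost_casimir_def Let_def by (intro acts_intros acts_irrep)
  also have "(\<lambda>\<phi> l.
      1 / 6 * (- (row_op a b gV (row_op a b gU \<phi>) l - row_op a b gU (row_op a b gV \<phi>) l)
      - (row_op a b gX (row_op a b gW \<phi>) l - row_op a b gW (row_op a b gX \<phi>) l)
      + (\<Sum>\<sigma> | \<sigma> permutes {0..<4}. of_int (sign \<sigma>) *
          row_op a b ([gU, gV, gW, gX] ! \<sigma> 3) (row_op a b ([gU, gV, gW, gX] ! \<sigma> 2)
            (row_op a b ([gU, gV, gW, gX] ! \<sigma> 1) (row_op a b ([gU, gV, gW, gX] ! \<sigma> 0) \<phi>))) l))) = ?T"
    by (intro ext) (simp only: split_paired_all prod.case row_ghost_casimir)
  finally show "acts a (ghost_casimir (4 * (a + 1)) (irrep a b)) ?T" .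
  show "acts a ((b * (b - of_nat a - 1)) \<cdot>\<^sub>m chi_mat a) ?T"
    by (rule acts_smult[OF acts_chi])
qed

lemma casimir3_irrep:
  "casimir3 (4 * (a + 1)) (irrep a b) =
    (1 / 2 * b * (b - of_nat a - 1) * (2 * b - of_nat a - 1)) \<cdot>\<^sub>m 1\<^sub>m (4 * (a + 1))"
proof (rule acts_unique)
  let ?r = "1 / 2 * b * (b - of_nat a - 1) * (2 * b - of_nat a - 1)"
  have "acts a (mat_sum (4 * (a + 1)) (\<lambda>x. case x of (A, B, C) \<Rightarrow>
        f3 (dual_basis C) (dual_basis B) (dual_basis A) \<cdot>\<^sub>m (irrep a b A * irrep a b B * irrep a b C))
        (gens \<times> gens \<times> gens))
      (\<lambda>\<phi> l. \<Sum>x\<in>gens \<times> gens \<times> gens. (\<lambda>\<phi> l. case x of (A, B, C) \<Rightarrow>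
        f3 (dual_basis C) (dual_basis B) (dual_basis A) * row_op a b C (row_op a b B (row_op a b A \<phi>)) l) \<phi> l)"
    by (intro acts_mat_sum) (clarsimp split: prod.splits, intro acts_intros acts_irrep)
  from acts_smult[OF this, of "1 / 6"]
  show "acts a (casimir3 (4 * (a + 1)) (irrep a b)) (\<lambda>\<phi> l. ?r * \<phi> l)"
    unfolding casimir3_def row_casimir3 .
  show "acts a (?r \<cdot>\<^sub>m 1\<^sub>m (4 * (a + 1))) (\<lambda>\<phi> l. ?r * \<phi> l)"
    by (intro acts_intros)
qed

section \<open>The \<open>N\<close>-generation representation\<close>

text \<open>Written with ring operations on the variable, the polynomial is carried by the
  homomorphism to the matrix expression of the theorem.\<close>

lemma J_eval_quadratic:
  "J_eval N \<alpha> [:x, y, 1:] = x \<cdot>\<^sub>m 1\<^sub>m N + y \<cdot>\<^sub>m J_mat N \<alpha> + J_mat N \<alpha> ^\<^sub>m 2"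
proof -
  have poly: "[:x, y, 1:] = smult x 1 + smult y [:0, 1:] + [:0, 1:] * [:0, 1:]"
    by (simp add: one_pCons)
  have "J_mat N \<alpha> \<in> carrier_mat N N"
    by (simp add: J_mat_def)
  then show ?thesis
    unfolding poly J_eval_add J_eval_smult J_eval_mult J_eval_1 J_eval_X
    by (simp add: numeral_2_eq_2 pow_mat.simps left_mult_one_mat)
qed

lemma J_eval_cubic:
  "J_eval N \<alpha> [:x, y, w, 1:] =
    x \<cdot>\<^sub>m 1\<^sub>m N + y \<cdot>\<^sub>m J_mat N \<alpha> + w \<cdot>\<^sub>m (J_mat N \<alpha> ^\<^sub>m 2) + J_mat N \<alpha> ^\<^sub>m 3"
proof -
  have poly: "[:x, y, w, 1:] = smult x 1 + smult y [:0, 1:] + smult w ([:0, 1:] * [:0, 1:]) +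
      [:0, 1:] * [:0, 1:] * [:0, 1:]"
    by (simp add: one_pCons)
  have "J_mat N \<alpha> \<in> carrier_mat N N"
    by (simp add: J_mat_def)
  then show ?thesis
    unfolding poly J_eval_add J_eval_smult J_eval_mult J_eval_1 J_eval_X
    by (simp add: numeral_2_eq_2 numeral_3_eq_3 pow_mat.simps left_mult_one_mat)
qed

theorem mainTheorem6:
  fixes a N d :: nat and b p q r s t :: complex and \<alpha> :: "nat \<Rightarrow> complex"
    and J :: "complex mat" and \<rho> :: "gen \<Rightarrow> complex mat"
  assumes "b * (b - of_nat a - 1) \<noteq> 0"
    and "N \<ge> 1"
    and "\<forall>i\<in>{1..<N}. \<alpha> i \<noteq> 0"
    and "d = 4 * (a + 1)"
    and "J = J_mat N \<alpha>"
    and "\<rho> = ngen_rep a b N \<alpha>"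
    and "p = b * (b - of_nat a - 1)"
    and "q = 2 * b - of_nat a - 1"
    and "r = 1 / 2 * b * (b - of_nat a - 1) * (2 * b - of_nat a - 1)"
    and "s = 3 * (b - of_nat a) * (b - 1) + 1 / 2 * ((of_nat a - 2)\<^sup>2 - 3)"
    and "t = 3 / 2 * (2 * b - of_nat a - 1)"
  shows "casimir2 \<rho> = (p \<cdot>\<^sub>m 1\<^sub>m N + q \<cdot>\<^sub>m J + J ^\<^sub>m 2) \<otimes>\<^sub>K 1\<^sub>m d
    \<and> ghost_casimir (N * d) \<rho> = (p \<cdot>\<^sub>m 1\<^sub>m N + q \<cdot>\<^sub>m J + J ^\<^sub>m 2) \<otimes>\<^sub>K chi_mat a
    \<and> casimir3 (N * d) \<rho> =
        (r \<cdot>\<^sub>m 1\<^sub>m N + s \<cdot>\<^sub>m J + t \<cdot>\<^sub>m (J ^\<^sub>m 2) + J ^\<^sub>m 3) \<otimes>\<^sub>K 1\<^sub>m d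
    \<and> ghost_casimir (N * d) \<rho> = casimir2 \<rho> * (1\<^sub>m N \<otimes>\<^sub>K chi_mat a)"
proof -
  have \<rho>: "J_subst N d \<alpha> (\<lambda>z. irrep a (b + z) A) (\<rho> A)" for A
    unfolding assms(4,6) by (rule J_subst_irrep)
  have chi: "chi_mat a \<in> carrier_mat d d"
    unfolding assms(4) by (rule rep_mat_carrier)
  \<comment> \<open>Expanding at \<open>b\<close> shows where \<open>q\<close>, \<open>s\<close> and
    \<open>t\<close> come from: they are the coefficients of the powers of \<open>z\<close>, and the
    leading coefficient is 1.\<close>
  have p: "(b + z) * (b + z - of_nat a - 1) = poly [:p, q, 1:] z" for z
    unfolding assms by (simp add: algebra_simps)
  have r: "1 / 2 * (b + z) * (b + z - of_nat a - 1) * (2 * (b + z) - of_nat a - 1) = poly [:r, s, t, 1:] z" for z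
    unfolding assms by (simp add: field_simps power2_eq_square)
  have c2: "J_subst N d \<alpha> (\<lambda>z. poly [:p, q, 1:] z \<cdot>\<^sub>m 1\<^sub>m d) (casimir2 \<rho>)"
    using J_subst_casimir2[where R = "\<lambda>z. irrep a (b + z)", OF \<rho>] unfolding casimir2_irrep p assms(4) .
  have T: "J_subst N d \<alpha> (\<lambda>z. poly [:p, q, 1:] z \<cdot>\<^sub>m chi_mat a) (ghost_casimir (N * d) \<rho>)"
    using J_subst_ghost_casimir[where R = "\<lambda>z. irrep a (b + z)", OF \<rho>] unfolding assms(4) ghost_casimir_irrep p .
  have c3: "J_subst N d \<alpha> (\<lambda>z. poly [:r, s, t, 1:] z \<cdot>\<^sub>m 1\<^sub>m d) (casimir3 (N * d) \<rho>)"
    using J_subst_casimir3[where R = "\<lambda>z. irrep a (b + z)", OF \<rho>] unfolding assms(4) casimir3_irrep r .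
  \<comment> \<open>The product of \<open>C_2\<close> with the chirality thus arises from the same
    family in \<open>z\<close> as \<open>T\<close>, so the two matrices agree.\<close>
  have "poly [:p, q, 1:] z \<cdot>\<^sub>m 1\<^sub>m d * chi_mat a = poly [:p, q, 1:] z \<cdot>\<^sub>m chi_mat a" for z
    using chi mult_smult_assoc_mat[OF one_carrier_mat chi] by simp
  then have c2_chi: "J_subst N d \<alpha> (\<lambda>z. poly [:p, q, 1:] z \<cdot>\<^sub>m chi_mat a) (casimir2 \<rho> * (1\<^sub>m N \<otimes>\<^sub>K chi_mat a))"
    using J_subst_mult[OF c2 J_subst_const[OF chi]] by simp
  show ?thesis
    \<comment> \<open>Each right-hand side becomes \<open>J_eval\<close> of a polynomial; by
      \<open>J_subst_kron\<close> it arises from the same family as the Casimir matrix, and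
      uniqueness applies.\<close>
    unfolding assms(5) J_eval_quadratic[symmetric] J_eval_cubic[symmetric]
    using J_subst_unique[OF c2 J_subst_kron] J_subst_unique[OF T J_subst_kron] J_subst_unique[OF T c2_chi]
      J_subst_unique[OF c3 J_subst_kron] chi one_carrier_mat by blast
qed

end
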